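(* Let $w,v\in\mathbb{C}$ and let $R\geq1$ be an integer. As real $n\to\infty$: \begin{align*} T_n(1;v)&=\sum_{r=0}^{R-1}\frac{1}{n^r}\left(-\rho_r(v)+\frac{\gamma_r(v)}{2}\sqrt{2\pi n}\right)+O\!\left(\frac{1}{n^{R-1/2}}\right),\\ T_n(w;v)&=-\sum_{r=0}^{R-1}\frac{U_r(w;v)}{n^r}+O\!\left(\frac1{n^R}\right)\qquad (w\in\mathcal{X}\cup\mathcal{Z}\cup\mathcal{T}),\\ T_n(w;v)&=\sum_{r=0}^{R-1}\frac{1}{n^r}\left(-U_r(w;v)+\gamma_r(v)\frac{e^{ni\varphi(w)}}{w^v}\sqrt{2\pi n}\right)+O\!\left(\frac{1}{n^{R-1/2}}\right)\qquad (w\in\mathcal{S}),\\ T_n(w;v)&=\frac{\sqrt{2\pi n}}{(we^{1-w})^n w^v}\left(\sum_{r=0}^{R-1}\frac{\gamma_r(v)}{n^r}+O\!\left(\frac1{n^R}\right)\right)\qquad(w\in\mathcal{Y},\ w\neq0). \end{align*}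
   Context: Logarithms use the principal branch with arguments in $(-\pi,\pi]$; $w^v=e^{v\log w}$, $(nw)^{-(n+v)}=e^{-(n+v)\log n}e^{-(n+v)\log w}$, and $(we^{1-w})^n:=e^{n\log w+n(1-w)}$. For real $n>0$, $v\in\mathbb{C}$ with $\mathrm{Re}(n+v)>-1$, $w\in\mathbb{C}$, let $S_n(w;v)=1+nw\int_0^1 e^{nw(1-z)}z^{n+v}\,dz$ and, for $w\neq0$, $T_n(w;v)=e^{nw}(nw)^{-(n+v)}\Gamma(n+v+1)-S_n(w;v)$ (for integers $n\geq1$, $n+v\geq0$ this is the number with $\frac{(nw)^{n+v}}{(n+v)!}T_n(w;v)=\sum_{j=0}^{n+v-1}\frac{(nw)^j}{j!}$). Regions: $\mathcal{X}=\{|we^{1-w}|>1\}$; $\mathcal{Y}=\{|we^{1-w}|<1,\mathrm{Re}(w)<1\}$; $\mathcal{Z}=\{|we^{1-w}|<1,\mathrm{Re}(w)>1\}$; $\mathcal{S}=\{|we^{1-w}|=1,\mathrm{Re}(w)<1\}$; $\mathcal{T}=\{|we^{1-w}|=1,\mathrm{Re}(w)>1\}$. For $|we^{1-w}|=1$, $\varphi(w):=\mathrm{Im}(w)-\arg(w)$, so $we^{1-w}=e^{-i\varphi(w)}$. De Moivre polynomial $\mathcal{A}_{n,k}(a_1,a_2,\dots)$: coefficient of $x^n$ in $(a_1x+a_2x^2+\cdots)^k$. Double factorial usual with $0!!=(-1)!!=1$; $\binom{v}{j}=v(v-1)\cdots(v-j+1)/j!$. Coefficients: $\rho_r(v)=\delta_{r,0}-\sum_{m=0}^{2r+1}(-1)^m\binom{v}{2r+1-m}\sum_{k=0}^{m}\frac{(2r+2k)!!}{(-1)^k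 k!}\mathcal{A}_{m,k}(\frac13,\frac14,\dots)$; $\gamma_r(v)=\sum_{m=0}^{2r}(-1)^m\binom{v}{2r-m}\sum_{k=0}^{m}\frac{(2r+2k-1)!!}{(-1)^k k!}\mathcal{A}_{m,k}(\frac13,\frac14,\dots)$; $U_r(w;v)=\delta_{r,0}-\sum_{m=0}^{r}(-1)^m\binom{v}{r-m}\sum_{k=0}^{m}\frac{w}{(w-1)^{r+k+1}}\frac{(r+k)!}{k!}\mathcal{A}_{m,k}(\frac12,\frac13,\dots)$. *)

theory Defs
  imports "HOL-Analysis.Analysis" "HOL-Library.Landau_Symbols"
    "HOL-Computational_Algebra.Formal_Power_Series"
begin

text \<open>Double factorial; (-1)!! = 0!! = 1 (so we use an int argument).\<close>
function dfact :: "int \<Rightarrow> nat" where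
  "dfact k = (if k \<le> 0 then 1 else nat k * dfact (k - 2))"
  by auto
termination by (relation "Wellfounded.measure (\<lambda>k. nat k)") auto

declare dfact.simps[simp del]

definition deMoivre :: "nat \<Rightarrow> nat \<Rightarrow> (nat \<Rightarrow> complex) \<Rightarrow> complex" where
  "deMoivre n k a = fps_nth ((Abs_fps (\<lambda>j. if j = 0 then 0 else a j)) ^ k) n"

text \<open>Sequences (1/3, 1/4, ...) and (1/2, 1/3, ...), indexed from 1.\<close>
definition seq3 :: "nat \<Rightarrow> complex" where "seq3 j = 1 / of_nat (j + 2)"
definition seq2 :: "nat \<Rightarrow> complex" where "seq2 j = 1 / of_nat (j + 1)"

definition rho_coef :: "nat \<Rightarrow> complex \<Rightarrow> complex" where
  "rho_coef r v = (if r = 0 then 1 else 0)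
     - (\<Sum>m=0..2*r+1. (-1)^m * (v gchoose (2*r+1-m)) *
          (\<Sum>k=0..m. of_nat (dfact (int (2*r+2*k))) / ((-1)^k * fact k) * deMoivre m k seq3))"

definition gamma_coef :: "nat \<Rightarrow> complex \<Rightarrow> complex" where
  "gamma_coef r v =
     (\<Sum>m=0..2*r. (-1)^m * (v gchoose (2*r-m)) *
          (\<Sum>k=0..m. of_nat (dfact (int (2*r+2*k) - 1)) / ((-1)^k * fact k) * deMoivre m k seq3))"

definition U_coef :: "nat \<Rightarrow> complex \<Rightarrow> complex \<Rightarrow> complex" where
  "U_coef r w v = (if r = 0 then 1 else 0)
     - (\<Sum>m=0..r. (-1)^m * (v gchoose (r-m)) *
          (\<Sum>k=0..m. w / (w - 1)^(r+k+1) * (fact (r+k) / fact k) * deMoivre m k seq2))"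

definition S_fun :: "real \<Rightarrow> complex \<Rightarrow> complex \<Rightarrow> complex" where
  "S_fun n w v = 1 + of_real n * w *
     integral {0..1} (\<lambda>z::real. exp (of_real n * w * of_real (1 - z)) * (of_real z) powr (of_real n + v))"

text \<open>T_n(w;v) = e^{nw} (nw)^{-(n+v)} \<Gamma>(n+v+1) - S_n(w;v), with
  (nw)^{-(n+v)} = e^{-(n+v) log n} e^{-(n+v) log w}.\<close>
definition T_fun :: "real \<Rightarrow> complex \<Rightarrow> complex \<Rightarrow> complex" where
  "T_fun n w v = exp (of_real n * w)
       * exp (- (of_real n + v) * of_real (ln n)) * exp (- (of_real n + v) * Ln w)
       * Gamma (of_real n + v + 1) - S_fun n w v"

definition wmod :: "complex \<Rightarrow> real" where "wmod w = cmod (w * exp (1 - w))"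

definition phi :: "complex \<Rightarrow> real" where "phi w = Im w - Arg w"

definition regX :: "complex set" where "regX = {w. wmod w > 1}"
definition regY :: "complex set" where "regY = {w. wmod w < 1 \<and> Re w < 1}"
definition regZ :: "complex set" where "regZ = {w. wmod w < 1 \<and> Re w > 1}"
definition regS :: "complex set" where "regS = {w. wmod w = 1 \<and> Re w < 1}"
definition regT :: "complex set" where "regT = {w. wmod w = 1 \<and> Re w > 1}"

end

theory Submission
  imports Defs "HOL-Complex_Analysis.Complex_Analysis" "HOL-Probability.Distributions"
    "HOL-Real_Asymp.Real_Asymp"
begin

text \<open>
  The integral in \<open>S_n(w;v)\<close> runs over \<open>exp (n (w (1 - z) + log z)) z^v\<close> for \<open>z\<close> from 0 to 1, and for
  \<open>Re w > 0\<close> Euler's integral turns \<open>T_n(w;v)\<close> into \<open>-1\<close> plus the same integral from 1 to infinity.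
  Since \<open>log z \<le> z - 1\<close>, the modulus of the integrand is largest at the endpoint \<open>z = 1\<close>, on the left
  if \<open>Re w \<le> 1\<close> and on the right if \<open>Re w \<ge> 1\<close>, so everything is decided by Laplace's
  method at that endpoint. There the phase is \<open>-(1 - w) t\<close> plus higher order terms if \<open>w \<noteq> 1\<close>, which
  produces the coefficients \<open>U_r\<close>, and \<open>-t^2/2\<close> plus higher order terms if \<open>w = 1\<close>, which produces
  \<open>\<gamma>_r\<close> and \<open>\<rho>_r\<close>. Adding the expansions of \<open>S_n(1;v)\<close> and \<open>T_n(1;v)\<close> cancels the \<open>\<rho>_r\<close> and gives
  Stirling's series for the Gamma factor with coefficients \<open>\<gamma>_r\<close>. For \<open>Re w \<le> 1\<close>, \<open>w \<noteq> 1\<close>, the size of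
  \<open>w exp (1 - w)\<close> decides whether the Gamma factor or \<open>S_n\<close> dominates \<open>T_n\<close>.
\<close>

section \<open>Laplace expansion at an endpoint\<close>

text \<open>The expansions at w = 1 proceed in half-integer powers of n, those elsewhere in integer
  powers. Putting z = 1 - u t and allowing a phase of order p in t treats both alike, with p = 2 or
  p = 1. For p = 2 the term t^r carries u^r, so passing from u = 1 to u = -1 reverses the sign of
  the odd terms only; this is why the \<rho>_r cancel and the \<gamma>_r survive when both
  directions are added. For p = 1 the direction cancels from the coefficients, so any path leaving 1
  with Re ((1 - w) u) > 0 produces the same U_r. Euler's integral is restricted to a half plane, so
  for the other w the Gamma term is factored as (w e^(1-w))^(-n) w^(-v) times a quantity free of w,
  which is known once the case w = 1 is done. That quantity has order sqrt n, so an exponential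
  factor always outweighs it. Since v is an arbitrary complex number, everything holds for large n
  only: n > |Re v| makes the integrand continuous at z = 0.\<close>

abbreviation powr_O :: "real \<Rightarrow> (real \<Rightarrow> complex) set" where
  "powr_O e \<equiv> O[at_top](\<lambda>n. complex_of_real (n powr e))"

section \<open>Calculus of errors of order \<open>n powr e\<close>\<close>

lemma powr_O_I:
  assumes "eventually (\<lambda>n. cmod (f n) \<le> C * n powr e) at_top"
  shows   "f \<in> powr_O e"
  using assms by (intro bigoI[of _ C]) simp

lemma powr_O_E:
  assumes "f \<in> powr_O e"
  obtains C where "C > 0" "eventually (\<lambda>n. cmod (f n) \<le> C * n powr e) at_top"
  using landau_o.bigE[OF assms] by (auto simp: norm_of_real)

lemma powr_O_mono:
  assumes "f \<in> powr_O a" "a \<le> b"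
  shows   "f \<in> powr_O b"
proof -
  obtain C where C: "C > 0" "eventually (\<lambda>n. cmod (f n) \<le> C * n powr a) at_top"
    using powr_O_E[OF assms(1)] .
  show ?thesis
  proof (rule powr_O_I[of _ C])
    show "eventually (\<lambda>n. cmod (f n) \<le> C * n powr b) at_top"
      using C(2) eventually_ge_at_top[of 1]
    proof eventually_elim
      case (elim n)
      have "C * n powr a \<le> C * n powr b"
        using elim C assms(2) by (intro mult_left_mono powr_mono) auto
      with elim show ?case by linarith
    qed
  qed
qed

lemma powr_O_cong:
  assumes "f \<in> powr_O e" "eventually (\<lambda>n. f n = g n) at_top"
  shows   "g \<in> powr_O e"
  using assms(1) unfolding landau_o.big.in_cong[OF assms(2)] .

lemma powr_O_mult:
  assumes "f \<in> powr_O a" "g \<in> powr_O b"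
  shows   "(\<lambda>n. f n * g n) \<in> powr_O (a + b)"
  using landau_o.big.mult[OF assms] by (simp add: powr_add)

lemma powr_O_mult':
  assumes "f \<in> powr_O a" "g \<in> powr_O b" "c = a + b"
  shows   "(\<lambda>n. f n * g n) \<in> powr_O c"
  using powr_O_mult[OF assms(1,2)] assms(3) by simp

lemma powr_O_cmult: "f \<in> powr_O a \<Longrightarrow> (\<lambda>n. c * f n) \<in> powr_O a"
  by (cases "c = 0") auto

lemma powr_O_powr: "(\<lambda>n. of_real (n powr a)) \<in> powr_O a"
  by simp

lemma powr_O_power: "(\<lambda>n. of_real n ^ k) \<in> powr_O (real k)"
proof (rule powr_O_I[of _ 1])
  show "eventually (\<lambda>n. cmod (of_real n ^ k) \<le> 1 * n powr real k) at_top"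
    using eventually_gt_at_top[of 0] by eventually_elim (auto simp: powr_realpow norm_power)
qed

lemma powr_O_sum:
  "(\<And>i. i \<in> A \<Longrightarrow> f i \<in> powr_O a) \<Longrightarrow> (\<lambda>n. \<Sum>i\<in>A. f i n) \<in> powr_O a"
  by (rule big_sum_in_bigo)

text \<open>Exponentially small terms are negligible at every power, so \<open>e\<close> is free;
  later steps choose it low enough to absorb any factor \<open>n ^ k\<close> in front of a
  tail.\<close>

lemma powr_O_exp:
  assumes "eventually (\<lambda>n. cmod (f n) \<le> C * exp (- (c * n))) at_top" "c > 0"
  shows   "f \<in> powr_O e"
proof -
  have "(\<lambda>n::real. exp (- (c * n))) \<in> O(\<lambda>n. n powr e)"
    using assms(2) by real_asymp
  then obtain K where K: "K > 0" "eventually (\<lambda>n. norm (exp (- (c * n))) \<le> K * norm (n powr e)) at_top"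
    using landau_o.bigE by blast
  show ?thesis
  proof (rule powr_O_I[of _ "\<bar>C\<bar> * K"])
    show "eventually (\<lambda>n. cmod (f n) \<le> \<bar>C\<bar> * K * n powr e) at_top"
      using assms(1) K(2)
    proof eventually_elim
      case (elim n)
      have "cmod (f n) \<le> \<bar>C\<bar> * exp (- (c * n))"
        using elim(1) by (smt (verit) exp_gt_zero mult_right_mono)
      also have "\<dots> \<le> \<bar>C\<bar> * (K * n powr e)"
        using elim(2) by (intro mult_left_mono) auto
      finally show ?case by (simp add: mult_ac)
    qed
  qed
qed

lemma divide_fact_le: "0 \<le> a \<Longrightarrow> a / fact k \<le> (a :: real)"
  using divide_left_mono[of 1 "fact k" a] by simp

text \<open>The phase is \<open>- b t^p + t^p Q(t)\<close> with \<open>Q(0) = 0\<close>. The term \<open>Q^k\<close> of the exponential series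
  carries a factor \<open>(n t^p)^k\<close>, which does not change the order \<open>n^(-(r+1)/p)\<close> of the
  contribution of \<open>t^r\<close>; since \<open>Q^M g = O(t^M)\<close>, truncating that series at \<open>k < M\<close> suffices.\<close>

lemma laplace_expansion:
  fixes p M :: nat and b :: complex and Q g :: "real \<Rightarrow> complex"
    and c :: "nat \<Rightarrow> nat \<Rightarrow> complex" and \<mu> :: "nat \<Rightarrow> complex" and \<delta> \<beta> :: real
  assumes p: "p \<ge> 1" and M: "M \<ge> 1" and \<delta>: "\<delta> > 0"
    and contQ: "continuous_on {0..\<delta>} Q" and contg: "continuous_on {0..\<delta>} g"
    and Q: "\<And>t. t \<in> {0..\<delta>} \<Longrightarrow> cmod (Q t) \<le> Re b - \<beta>"
    and moment: "\<And>l e. (\<lambda>n. integral {0..\<delta>} (\<lambda>t. exp (- (of_real (n * t ^ p) * b)) * of_real (t ^ l))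
                        - \<mu> l * of_real (n powr (- real (l + 1) / real p))) \<in> powr_O e"
    and moment_bound: "\<And>l. (\<lambda>n. of_real (integral {0..\<delta>} (\<lambda>t. exp (- (n * t ^ p * \<beta>)) * t ^ l)))
                        \<in> powr_O (- real (l + 1) / real p)"
    and taylor: "\<And>k. k \<le> M \<Longrightarrow> \<exists>C. \<forall>t\<in>{0..\<delta>}. cmod (Q t ^ k * g t - (\<Sum>r<M. c k r * of_real (t ^ r))) \<le> C * t ^ M"
    and cM: "\<And>r. r < M \<Longrightarrow> c M r = 0"
  shows "(\<lambda>n. integral {0..\<delta>} (\<lambda>t. exp (of_real n * (- b * of_real (t ^ p) + of_real (t ^ p) * Q t)) * g t)
           - (\<Sum>r<M. of_real (n powr (- real (r + 1) / real p)) * (\<Sum>k<M. c k r / fact k * \<mu> (p * k + r))))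
         \<in> powr_O (- real (M + 1) / real p)"
proof -
  define E where "E n t = exp (- (complex_of_real (n * t ^ p) * b))" for n t :: real
  define F where "F n t = exp (of_real n * (- b * of_real (t ^ p) + of_real (t ^ p) * Q t)) * g t" for n t :: real
  define P where "P k t = (\<Sum>r<M. c k r * complex_of_real (t ^ r))" for k and t :: real
  define A where "A n t = E n t * (\<Sum>k<M. of_real (n * t ^ p) ^ k / fact k * P k t)" for n t :: real
  define I where "I l n = integral {0..\<delta>} (\<lambda>t. E n t * of_real (t ^ l))" for l :: nat and n :: real
  define J where "J l n = integral {0..\<delta>} (\<lambda>t. exp (- (n * t ^ p * \<beta>)) * t ^ l)" for l :: nat and n :: real
  have "\<exists>C. \<forall>k\<le>M. \<forall>t\<in>{0..\<delta>}. cmod (Q t ^ k * g t - P k t) \<le> C k * t ^ M"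
    using taylor unfolding P_def by metis
  then obtain C0 where C0: "\<And>k t. k \<le> M \<Longrightarrow> t \<in> {0..\<delta>} \<Longrightarrow> cmod (Q t ^ k * g t - P k t) \<le> C0 k * t ^ M"
    by blast
  \<comment> \<open>One constant for all k \<le> M; the absolute values spare a proof that the
    \<open>C0 k\<close> are nonnegative.\<close>
  define C where "C = (\<Sum>k\<le>M. \<bar>C0 k\<bar>)"
  have C: "cmod (Q t ^ k * g t - P k t) \<le> C * t ^ M" if "k \<le> M" "t \<in> {0..\<delta>}" for k t
  proof -
    have "C0 k \<le> \<bar>C0 k\<bar>" by simp
    also have "\<dots> \<le> C" unfolding C_def by (rule member_le_sum) (use that in auto)
    finally have "C0 k * t ^ M \<le> C * t ^ M" using that by (intro mult_right_mono) auto
    thus ?thesis using C0[OF that] by linarith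
  qed
  have contE: "continuous_on {0..\<delta>} (E n)" for n
    unfolding E_def by (intro continuous_intros)
  have contF: "continuous_on {0..\<delta>} (F n)" for n
    unfolding F_def by (intro continuous_intros contQ contg)
  have contA: "continuous_on {0..\<delta>} (A n)" for n
    unfolding A_def P_def by (intro continuous_intros contE) auto
  have intI: "(\<lambda>t. E n t * of_real (t ^ l)) integrable_on {0..\<delta>}" for n l
    by (intro integrable_continuous_interval continuous_intros contE)

  have bound: "cmod (F n t - A n t) \<le> (\<Sum>k\<le>M. C * n ^ k * (exp (- (n * t ^ p * \<beta>)) * t ^ (p * k + M)))"
    if n: "n > 0" and t: "t \<in> {0..\<delta>}" for n t
  proof -
    define x where "x = complex_of_real (n * t ^ p) * Q t"
    have t0: "t \<ge> 0" and nt: "n * t ^ p \<ge> 0" using n t by auto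
    have Feq: "F n t = E n t * (exp x * g t)"
      unfolding F_def E_def x_def by (simp add: exp_add [symmetric] algebra_simps)
    define X where "X = (\<Sum>k<M. x ^ k / fact k)"
    have Xg: "X * g t = (\<Sum>k<M. of_real (n * t ^ p) ^ k / fact k * (Q t ^ k * g t))"
      unfolding X_def x_def sum_distrib_right by (intro sum.cong) (simp_all add: power_mult_distrib)
    \<comment> \<open>The error splits into the tail of the exponential series, controlled by
      \<open>Q t ^ M * g t\<close>, and the Taylor remainders of the retained terms.\<close>
    have dec: "F n t - A n t = E n t * ((exp x - X) * g t
        + (\<Sum>k<M. of_real (n * t ^ p) ^ k / fact k * (Q t ^ k * g t - P k t)))"
    proof -
      have "(\<Sum>k<M. of_real (n * t ^ p) ^ k / fact k * (Q t ^ k * g t - P k t))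
         = X * g t - (\<Sum>k<M. of_real (n * t ^ p) ^ k / fact k * P k t)"
        by (simp only: right_diff_distrib sum_subtractf Xg)
      thus ?thesis unfolding Feq A_def by (simp only: ring_distribs) simp
    qed
    have normE: "cmod (E n t) = exp (- (n * t ^ p * Re b))"
      unfolding E_def by simp
    have normE': "cmod (E n t) \<le> exp (- (n * t ^ p * \<beta>))"
    proof -
      have "\<beta> \<le> Re b" using Q[OF t] norm_ge_zero[of "Q t"] by linarith
      thus ?thesis unfolding normE using nt by (simp add: mult_left_mono)
    qed
    have Mset: "{..<M} = {..M-1}" using M by auto
    have "cmod (exp x - X) \<le> exp (cmod x) * cmod x ^ M / fact (M - 1)"
      using Taylor_exp_field[of x "M - 1"] M unfolding X_def Mset by simp
    also have "\<dots> \<le> exp (cmod x) * cmod x ^ M"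
      by (rule divide_fact_le) simp
    finally have ex: "cmod (exp x - X) \<le> exp (cmod x) * cmod x ^ M" .
    \<comment> \<open>The Taylor polynomial for k = M vanishes, so the hypothesis at k = M reads Q^M
      g = O(t^M), the bound that the exponential tail needs.\<close>
    have PM: "P M t = 0" unfolding P_def using cM by simp
    have normx: "cmod x = n * t ^ p * cmod (Q t)"
      unfolding x_def using nt by (simp add: norm_mult norm_power abs_mult n t0 less_imp_le)
    have "cmod (E n t * ((exp x - X) * g t)) \<le> cmod (E n t) * (exp (cmod x) * cmod x ^ M * cmod (g t))"
      unfolding norm_mult using ex by (intro mult_left_mono mult_right_mono) auto
    also have "\<dots> = (cmod (E n t) * exp (cmod x)) * ((n * t ^ p) ^ M * cmod (Q t ^ M * g t - P M t))"
      by (simp add: normx PM norm_mult norm_power power_mult_distrib)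
    also have "\<dots> \<le> exp (- (n * t ^ p * \<beta>)) * ((n * t ^ p) ^ M * (C * t ^ M))"
    proof (intro mult_mono)
      \<comment> \<open>The factor exp |x| from the tail costs at most n t^p (Re b - \<beta>) in the
        exponent, which leaves decay at rate \<beta>.\<close>
      have "n * t ^ p * cmod (Q t) \<le> n * t ^ p * (Re b - \<beta>)"
        using Q[OF t] nt by (intro mult_left_mono) auto
      thus "cmod (E n t) * exp (cmod x) \<le> exp (- (n * t ^ p * \<beta>))"
        unfolding normE normx exp_add [symmetric] by (simp add: algebra_simps)
    qed (use nt C[of M t] t in auto)
    also have "\<dots> = C * n ^ M * (exp (- (n * t ^ p * \<beta>)) * t ^ (p * M + M))"
      by (simp add: power_mult_distrib power_add power_mult)
    finally have part1: "cmod (E n t * ((exp x - X) * g t)) \<le> \<dots>" .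
    have "cmod (E n t * (\<Sum>k<M. of_real (n * t ^ p) ^ k / fact k * (Q t ^ k * g t - P k t)))
       \<le> exp (- (n * t ^ p * \<beta>)) * (\<Sum>k<M. (n * t ^ p) ^ k * (C * t ^ M))"
      unfolding norm_mult
    proof (intro mult_mono normE' order.trans[OF norm_sum] sum_mono)
      fix k assume k: "k \<in> {..<M}"
      have "cmod (of_real (n * t ^ p) ^ k / fact k * (Q t ^ k * g t - P k t))
          = (n * t ^ p) ^ k / fact k * cmod (Q t ^ k * g t - P k t)"
        using nt by (simp add: norm_mult norm_divide norm_power abs_mult n t0 less_imp_le power_mult_distrib)
      also have "\<dots> \<le> (n * t ^ p) ^ k * (C * t ^ M)"
      proof (intro mult_mono)
        show "(n * t ^ p) ^ k / fact k \<le> (n * t ^ p) ^ k"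
          using nt by (intro divide_fact_le) simp
      qed (use nt C[of k t] t k in auto)
      finally show "cmod (of_real (n * t ^ p) ^ k / fact k * (Q t ^ k * g t - P k t)) \<le> \<dots>" .
    qed auto
    also have "\<dots> = (\<Sum>k<M. C * n ^ k * (exp (- (n * t ^ p * \<beta>)) * t ^ (p * k + M)))"
      unfolding sum_distrib_left
      by (intro sum.cong) (simp_all add: power_mult_distrib power_add power_mult)
    finally have part2: "cmod (E n t * (\<Sum>k<M. of_real (n * t ^ p) ^ k / fact k * (Q t ^ k * g t - P k t))) \<le> \<dots>" .
    have "cmod (F n t - A n t) \<le> cmod (E n t * ((exp x - X) * g t))
       + cmod (E n t * (\<Sum>k<M. of_real (n * t ^ p) ^ k / fact k * (Q t ^ k * g t - P k t)))"
      unfolding dec distrib_left by (rule norm_triangle_ineq)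
    also note add_mono[OF part1 part2]
    finally show ?thesis
      by (simp only: lessThan_Suc_atMost [symmetric] sum.lessThan_Suc add.commute)
  qed

  have int_bound: "cmod (integral {0..\<delta>} (F n) - integral {0..\<delta>} (A n))
      \<le> cmod (\<Sum>k\<le>M. of_real C * (of_real n ^ k * of_real (J (p * k + M) n)))" if n: "n > 0" for n
  proof -
    have "cmod (integral {0..\<delta>} (\<lambda>t. F n t - A n t))
      \<le> integral {0..\<delta>} (\<lambda>t. \<Sum>k\<le>M. C * n ^ k * (exp (- (n * t ^ p * \<beta>)) * t ^ (p * k + M)))"
      by (rule integral_norm_bound_integral)
         (use bound n in \<open>auto intro!: integrable_continuous_interval continuous_intros contF contA\<close>)
    also have "\<dots> = (\<Sum>k\<le>M. C * (n ^ k * J (p * k + M) n))"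
      unfolding J_def by (subst integral_sum) (auto intro!: integrable_continuous_interval continuous_intros simp: mult_ac)
    also have "\<dots> \<le> cmod (of_real (\<Sum>k\<le>M. C * (n ^ k * J (p * k + M) n)))"
      unfolding norm_of_real by (rule abs_ge_self)
    also have "integral {0..\<delta>} (\<lambda>t. F n t - A n t) = integral {0..\<delta>} (F n) - integral {0..\<delta>} (A n)"
      by (intro integral_diff integrable_continuous_interval contF contA)
    finally show ?thesis by simp
  qed
  have "(\<lambda>n. \<Sum>k\<le>M. of_real C * (of_real n ^ k * of_real (J (p * k + M) n))) \<in> powr_O (- real (M + 1) / real p)"
  proof (intro powr_O_sum powr_O_cmult)
    fix k
    \<comment> \<open>Raising k by one multiplies by n and raises the moment index by p, which gains
      1/n; hence all error terms have the same order.\<close>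
    have "real k + - real (p * k + M + 1) / real p = - real (M + 1) / real p"
      using p by (simp add: field_simps)
    with powr_O_mult[OF powr_O_power[of k] moment_bound[of "p * k + M"]]
    show "(\<lambda>n. of_real n ^ k * of_real (J (p * k + M) n)) \<in> powr_O (- real (M + 1) / real p)"
      unfolding J_def by simp
  qed
  moreover have "(\<lambda>n. integral {0..\<delta>} (F n) - integral {0..\<delta>} (A n))
      \<in> O(\<lambda>n. \<Sum>k\<le>M. of_real C * (of_real n ^ k * of_real (J (p * k + M) n)))"
  proof (rule landau_o.bigI[of 1])
    show "eventually (\<lambda>n. cmod (integral {0..\<delta>} (F n) - integral {0..\<delta>} (A n))
      \<le> 1 * cmod (\<Sum>k\<le>M. of_real C * (of_real n ^ k * of_real (J (p * k + M) n)))) at_top"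
      using eventually_gt_at_top[of 0] by eventually_elim (use int_bound in simp)
  qed simp
  ultimately have main1: "(\<lambda>n. integral {0..\<delta>} (F n) - integral {0..\<delta>} (A n)) \<in> powr_O (- real (M + 1) / real p)"
    by (rule landau_o.big.trans[rotated])

  have intA: "integral {0..\<delta>} (A n) = (\<Sum>r<M. \<Sum>k<M. c k r / fact k * (of_real n ^ k * I (p * k + r) n))" for n
  proof -
    have "A n t = (\<Sum>k<M. \<Sum>r<M. c k r / fact k * of_real n ^ k * (E n t * of_real (t ^ (p * k + r))))" for t
      unfolding A_def P_def sum_distrib_left
      by (intro sum.cong) (simp_all add: power_mult_distrib power_add power_mult [symmetric] mult_ac)
    hence "A n = (\<lambda>t. \<Sum>k<M. \<Sum>r<M. c k r / fact k * of_real n ^ k * (E n t * of_real (t ^ (p * k + r))))"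
      by auto
    moreover have "((\<lambda>t. \<Sum>k<M. \<Sum>r<M. c k r / fact k * of_real n ^ k * (E n t * of_real (t ^ (p * k + r))))
        has_integral (\<Sum>k<M. \<Sum>r<M. c k r / fact k * of_real n ^ k * I (p * k + r) n)) {0..\<delta>}"
      unfolding I_def by (intro has_integral_sum finite_lessThan has_integral_mult_right integrable_integral intI)
    ultimately have "integral {0..\<delta>} (A n) = (\<Sum>k<M. \<Sum>r<M. c k r / fact k * of_real n ^ k * I (p * k + r) n)"
      by (simp add: integral_unique)
    thus ?thesis by (subst sum.swap) (simp add: mult_ac)
  qed
  have "(\<lambda>n. \<Sum>r<M. \<Sum>k<M. c k r / fact k *
           (of_real n ^ k * (I (p * k + r) n - \<mu> (p * k + r) * of_real (n powr (- real (p * k + r + 1) / real p)))))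
      \<in> powr_O (- real (M + 1) / real p)"
  proof (intro powr_O_sum powr_O_cmult)
    fix k r
    \<comment> \<open>The moment errors are smaller than every power, so lowering the exponent by k
      absorbs the factor \<open>n ^ k\<close>.\<close>
    show "(\<lambda>n. of_real n ^ k * (I (p * k + r) n - \<mu> (p * k + r) * of_real (n powr (- real (p * k + r + 1) / real p))))
        \<in> powr_O (- real (M + 1) / real p)"
      using powr_O_mult[OF powr_O_power[of k] moment[of "p * k + r" "- real (M + 1) / real p - real k"]]
      unfolding I_def E_def by simp
  qed
  moreover have "eventually (\<lambda>n. (\<Sum>r<M. \<Sum>k<M. c k r / fact k *
           (of_real n ^ k * (I (p * k + r) n - \<mu> (p * k + r) * of_real (n powr (- real (p * k + r + 1) / real p)))))
       = integral {0..\<delta>} (A n)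
          - (\<Sum>r<M. of_real (n powr (- real (r + 1) / real p)) * (\<Sum>k<M. c k r / fact k * \<mu> (p * k + r)))) at_top"
    using eventually_gt_at_top[of 0]
  proof eventually_elim
    case (elim n)
    have "complex_of_real n ^ k * of_real (n powr (- real (p * k + r + 1) / real p))
        = of_real (n powr (- real (r + 1) / real p))" for k r
    proof -
      have "real k + - real (p * k + r + 1) / real p = - real (r + 1) / real p"
        using p by (simp add: field_simps)
      moreover have "n ^ k * n powr (- real (p * k + r + 1) / real p) = n powr (real k + - real (p * k + r + 1) / real p)"
        using elim by (simp only: powr_add powr_realpow)
      ultimately show ?thesis by (metis of_real_mult of_real_power)
    qed
    hence *: "of_real n ^ k * (I (p * k + r) n - \<mu> (p * k + r) * of_real (n powr (- real (p * k + r + 1) / real p)))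
       = of_real n ^ k * I (p * k + r) n - \<mu> (p * k + r) * of_real (n powr (- real (r + 1) / real p))" for k r
      by (simp add: right_diff_distrib mult.left_commute)
    show ?case unfolding intA *
      by (simp add: right_diff_distrib sum_subtractf sum_distrib_left mult_ac)
  qed
  ultimately have main2: "(\<lambda>n. integral {0..\<delta>} (A n)
          - (\<Sum>r<M. of_real (n powr (- real (r + 1) / real p)) * (\<Sum>k<M. c k r / fact k * \<mu> (p * k + r))))
       \<in> powr_O (- real (M + 1) / real p)"
    by (rule powr_O_cong)
  show ?thesis
    using sum_in_bigo(1)[OF main1 main2] unfolding F_def by simp
qed

section \<open>Exponential and Gaussian moments\<close>

lemma integral_of_real_continuous:
  fixes f :: "real \<Rightarrow> real"
  assumes "continuous_on {a..b} f"
  shows "integral {a..b} (\<lambda>t. complex_of_real (f t)) = of_real (integral {a..b} f)"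
  using assms by (intro integral_unique has_integral_of_real integrable_integral integrable_continuous_interval)

text \<open>Both identities integrate a total derivative over [0,\<delta>]: that of E(t) = exp (- n
  b t^p) and that of t^(l+1) E(t). Differentiating E produces t^(p-1), so the recursion starts at
  index p - 1 and advances by p.\<close>

lemma moment_integrals:
  fixes b :: complex and n \<delta> :: real and p :: nat
  assumes "p \<ge> 1" "\<delta> \<ge> 0"
  defines "I \<equiv> \<lambda>l. integral {0..\<delta>} (\<lambda>t. exp (- (of_real (n * t ^ p) * b)) * of_real (t ^ l))"
  shows moment_integral_base: "of_nat p * of_real n * b * I (p - 1) = 1 - exp (- (of_real (n * \<delta> ^ p) * b))"
    and moment_integral_step: "of_nat p * of_real n * b * I (l + p)
           = of_nat (l + 1) * I l - of_real (\<delta> ^ (l + 1)) * exp (- (of_real (n * \<delta> ^ p) * b))"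
proof -
  define E where "E t = exp (- (of_real (n * t ^ p) * b))" for t :: real
  have int: "(\<lambda>t. E t * of_real (t ^ l)) integrable_on {0..\<delta>}" for l
    unfolding E_def by (intro integrable_continuous_interval continuous_intros)
  have dE: "((\<lambda>z. exp (- (of_real n * z ^ p * b))) has_field_derivative
              - (of_nat p * of_real n * b * (exp (- (of_real n * z ^ p * b)) * z ^ (p - 1)))) (at z)" for z :: complex
    by (auto intro!: derivative_eq_intros simp: mult_ac)
  have dE': "(E has_vector_derivative - (of_nat p * of_real n * b * (E t * of_real (t ^ (p - 1))))) (at t)" for t
    using has_vector_derivative_real_field[OF dE[of "of_real t"]] by (simp add: E_def[abs_def])
  have "((\<lambda>t. - (of_nat p * of_real n * b * (E t * of_real (t ^ (p - 1))))) has_integral (E \<delta> - E 0)) {0..\<delta>}"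
    using assms(2) dE' by (intro fundamental_theorem_of_calculus) (auto intro: has_vector_derivative_at_within)
  from integral_unique[OF this] have h1: "- (of_nat p * of_real n * b * I (p - 1)) = E \<delta> - E 0"
    unfolding I_def E_def [symmetric] by (simp only: integral_neg integral_mult_right)
  have E0: "E 0 = 1" using assms(1) by (simp add: E_def power_0_left)
  have r1: "x = 1 - y" if "- x = y - z" "z = 1" for x y z :: complex
    using that by (auto simp: algebra_simps)
  show "of_nat p * of_real n * b * I (p - 1) = 1 - exp (- (of_real (n * \<delta> ^ p) * b))"
    unfolding E_def [symmetric] by (rule r1[OF h1 E0])
  have "((\<lambda>t. of_nat (l + 1) * (E t * of_real (t ^ l)) - of_nat p * of_real n * b * (E t * of_real (t ^ (l + p))))
          has_integral (of_real (\<delta> ^ (l + 1)) * E \<delta> - of_real (0 ^ (l + 1)) * E 0)) {0..\<delta>}"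
  proof (rule fundamental_theorem_of_calculus[OF assms(2)], rule has_vector_derivative_at_within)
    fix t :: real
    have pow: "((\<lambda>t. of_real (t ^ (l + 1))) has_vector_derivative of_nat (l + 1) * complex_of_real (t ^ l)) (at t)"
      unfolding of_real_power
      by (rule has_vector_derivative_real_field[of "\<lambda>z. z ^ (l + 1)"])
         (use DERIV_power[OF DERIV_ident, of "l + 1"] in simp)
    obtain q where q: "p = Suc q" using assms(1) by (cases p) auto
    have h: "complex_of_real (t ^ (l + 1)) * of_real (t ^ (p - 1)) = of_real (t ^ (l + p))"
      unfolding q of_real_mult [symmetric] power_add [symmetric] by simp
    have gen: "x * (- (c * (e * y))) + m * z * e = m * (e * z) - c * (e * w)"
      if "x * y = w" for x y z w c m e :: complex
      unfolding that [symmetric] by (simp add: algebra_simps)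
    have "of_real (t ^ (l + 1)) * (- (of_nat p * of_real n * b * (E t * of_real (t ^ (p - 1))))) + of_nat (l + 1) * of_real (t ^ l) * E t
       = of_nat (l + 1) * (E t * of_real (t ^ l)) - of_nat p * of_real n * b * (E t * of_real (t ^ (l + p)))"
      by (rule gen[OF h])
    with has_vector_derivative_mult[OF pow dE'[of t]]
    show "((\<lambda>t. of_real (t ^ (l + 1)) * E t) has_vector_derivative
            of_nat (l + 1) * (E t * of_real (t ^ l)) - of_nat p * of_real n * b * (E t * of_real (t ^ (l + p)))) (at t)"
      by (simp only:)
  qed
  moreover have "((\<lambda>t. of_nat (l + 1) * (E t * of_real (t ^ l)) - of_nat p * of_real n * b * (E t * of_real (t ^ (l + p))))
          has_integral (of_nat (l + 1) * I l - of_nat p * of_real n * b * I (l + p))) {0..\<delta>}"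
    unfolding I_def E_def [symmetric]
    by (intro has_integral_diff has_integral_mult_right integrable_integral int)
  ultimately have h2: "of_nat (l + 1) * I l - of_nat p * of_real n * b * I (l + p)
      = of_real (\<delta> ^ (l + 1)) * E \<delta> - of_real (0 ^ (l + 1)) * E 0"
    by (rule has_integral_unique[rotated])
  have r2: "y = x - z" if "x - y = z - of_real (0 ^ (l + 1)) * w" for x y z w :: complex
    using that by (auto simp: algebra_simps)
  show "of_nat p * of_real n * b * I (l + p)
           = of_nat (l + 1) * I l - of_real (\<delta> ^ (l + 1)) * exp (- (of_real (n * \<delta> ^ p) * b))"
    unfolding E_def [symmetric] by (rule r2[OF h2])
qed

text \<open>\<open>\<mu>\<close> obeys the recursion of the truncated moments without the boundary
  terms at \<delta>. These are exponentially small, so the error stays below every power of n.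
  Indices below p - 1 have no predecessor and must be supplied: none for p = 1, only 0 for p =
  2.\<close>

lemma moment_expansion:
  fixes b :: complex and \<delta> :: real and p :: nat and \<mu> :: "nat \<Rightarrow> complex"
  assumes p: "p \<ge> 1" and \<delta>: "\<delta> > 0" and b: "Re b > 0"
    and \<mu>_base: "\<mu> (p - 1) = 1 / (of_nat p * b)"
    and \<mu>_step: "\<And>l. \<mu> (l + p) = of_nat (l + 1) / (of_nat p * b) * \<mu> l"
  defines "I \<equiv> \<lambda>l n. integral {0..\<delta>} (\<lambda>t. exp (- (of_real (n * t ^ p) * b)) * of_real (t ^ l))"
  assumes small: "\<And>l e. l < p - 1 \<Longrightarrow> (\<lambda>n. I l n - \<mu> l * of_real (n powr (- real (l + 1) / real p))) \<in> powr_O e"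
  shows "(\<lambda>n. I l n - \<mu> l * of_real (n powr (- real (l + 1) / real p))) \<in> powr_O e"
proof (induction l arbitrary: e rule: less_induct)
  case (less l)
  have b0: "b \<noteq> 0" using b by auto
  have exp_small: "(\<lambda>n. exp (- (of_real (n * \<delta> ^ p) * b))) \<in> powr_O e" for e
    by (rule powr_O_exp[of _ 1 "\<delta> ^ p * Re b"]) (use \<delta> b in \<open>auto simp: mult_ac\<close>)
  show ?case
  proof (cases "l < p - 1")
    case True
    thus ?thesis by (rule small)
  next
    case False
    show ?thesis
    proof (cases "l = p - 1")
      case True
      have "(\<lambda>n. (- 1 / (of_nat p * b)) * (of_real (n powr (- 1)) * exp (- (of_real (n * \<delta> ^ p) * b)))) \<in> powr_O e"
        by (intro powr_O_cmult powr_O_mult'[OF powr_O_powr exp_small[of "e + 1"]]) simp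
      moreover have "eventually (\<lambda>n. (- 1 / (of_nat p * b)) * (of_real (n powr (- 1)) * exp (- (of_real (n * \<delta> ^ p) * b)))
          = I l n - \<mu> l * of_real (n powr (- real (l + 1) / real p))) at_top"
        using eventually_gt_at_top[of 0]
      proof eventually_elim
        case (elim n)
        have e1: "n powr (- real (l + 1) / real p) = n powr (- 1)" using True p by simp
        have e2: "n powr (- 1) = 1 / n" using elim by (simp add: powr_minus_divide)
        have "I l n = (1 - exp (- (of_real (n * \<delta> ^ p) * b))) / (of_nat p * of_real n * b)"
          using moment_integral_base[of p \<delta> n b] p \<delta> b0 elim True unfolding I_def
          by (simp add: field_simps)
        thus ?case unfolding e1 e2 using p elim b0 \<mu>_base True by (simp add: field_simps)
      qed
      ultimately show ?thesis by (rule powr_O_cong)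
    next
      case False
      with \<open>\<not> l < p - 1\<close> have "l = (l - p) + p" by simp
      then obtain k where k: "l = k + p" by blast
      \<comment> \<open>A step of the recursion divides by n, so exponent e + 1 is good enough at
        index k.\<close>
      have IH: "(\<lambda>n. I k n - \<mu> k * of_real (n powr (- real (k + 1) / real p))) \<in> powr_O (e + 1)"
        using p by (intro less.IH) (auto simp: k)
      have "(\<lambda>n. of_nat (k + 1) / (of_nat p * b) *
               (of_real (n powr (- 1)) * (I k n - \<mu> k * of_real (n powr (- real (k + 1) / real p))))
              - of_real (\<delta> ^ (k + 1)) / (of_nat p * b) * (of_real (n powr (- 1)) * exp (- (of_real (n * \<delta> ^ p) * b))))
            \<in> powr_O e"
        by (intro sum_in_bigo powr_O_cmult powr_O_mult'[OF powr_O_powr IH]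
              powr_O_mult'[OF powr_O_powr exp_small[of "e + 1"]]) simp_all
      moreover have "eventually (\<lambda>n. of_nat (k + 1) / (of_nat p * b) *
               (of_real (n powr (- 1)) * (I k n - \<mu> k * of_real (n powr (- real (k + 1) / real p))))
              - of_real (\<delta> ^ (k + 1)) / (of_nat p * b) * (of_real (n powr (- 1)) * exp (- (of_real (n * \<delta> ^ p) * b)))
          = I l n - \<mu> l * of_real (n powr (- real (l + 1) / real p))) at_top"
        using eventually_gt_at_top[of 0]
      proof eventually_elim
        case (elim n)
        have "- real (l + 1) / real p = - 1 + - real (k + 1) / real p" using p k by (simp add: field_simps)
        hence e1: "n powr (- real (l + 1) / real p) = n powr (- 1) * n powr (- real (k + 1) / real p)"
          by (simp only: powr_add)
        have e2: "n powr (- 1) = 1 / n" using elim by (simp add: powr_minus_divide)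
        have "I l n = (of_nat (k + 1) * I k n - of_real (\<delta> ^ (k + 1)) * exp (- (of_real (n * \<delta> ^ p) * b)))
                / (of_nat p * of_real n * b)"
          using moment_integral_step[of p \<delta> n b k] p \<delta> b0 elim unfolding I_def k
          by (simp add: field_simps)
        moreover have "x / (y * b) * (1 / z * (i - m * N)) - d / (y * b) * (1 / z * X)
            = (x * i - d * X) / (y * z * b) - x / (y * b) * m * (1 / z * N)" for x y z i m N d X :: complex
          by (simp add: divide_inverse algebra_simps)
        ultimately show ?case unfolding k e1[unfolded k] \<mu>_step e2 of_real_mult of_real_divide of_real_1
          by (simp only:)
      qed
      ultimately show ?thesis by (rule powr_O_cong)
    qed
  qed
qed

text \<open>The moment expansion for the real rate \<beta>, with error exponent equal to that of the
  leading term, gives the size of the dominating integrals in the Laplace estimate.\<close>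

lemma moment_bound:
  fixes \<beta> \<delta> :: real and p :: nat and \<mu> :: "nat \<Rightarrow> complex"
  assumes "\<And>e. (\<lambda>n. integral {0..\<delta>} (\<lambda>t. exp (- (of_real (n * t ^ p) * of_real \<beta>)) * of_real (t ^ l))
              - \<mu> l * of_real (n powr (- real (l + 1) / real p))) \<in> powr_O e"
  shows "(\<lambda>n. of_real (integral {0..\<delta>} (\<lambda>t. exp (- (n * t ^ p * \<beta>)) * t ^ l))) \<in> powr_O (- real (l + 1) / real p)"
proof -
  have "integral {0..\<delta>} (\<lambda>t. exp (- (complex_of_real (n * t ^ p) * of_real \<beta>)) * of_real (t ^ l))
      = of_real (integral {0..\<delta>} (\<lambda>t. exp (- (n * t ^ p * \<beta>)) * t ^ l))" for n
  proof -
    have "exp (- (complex_of_real (n * t ^ p) * of_real \<beta>)) * of_real (t ^ l)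
        = of_real (exp (- (n * t ^ p * \<beta>)) * t ^ l)" for t
      by (simp only: of_real_mult of_real_minus exp_of_real [symmetric])
    thus ?thesis by (simp only: integral_of_real_continuous continuous_intros)
  qed
  with sum_in_bigo(1)[OF assms powr_O_cmult[OF powr_O_powr[of "- real (l + 1) / real p"], of "\<mu> l"]]
  show ?thesis by simp
qed

text \<open>\<open>fact l / b ^ (l + 1)\<close> is the integral of exp (- b t) t^l over the half
  line; for p = 1 no starting values are missing.\<close>

lemma exponential_moments:
  fixes b :: complex and \<delta> :: real
  assumes "\<delta> > 0" "Re b > 0"
  shows "(\<lambda>n. integral {0..\<delta>} (\<lambda>t. exp (- (of_real (n * t ^ 1) * b)) * of_real (t ^ l))
           - fact l / b ^ (l + 1) * of_real (n powr (- real (l + 1) / real 1))) \<in> powr_O e"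
  by (rule moment_expansion[where \<mu> = "\<lambda>l. fact l / b ^ (l + 1)"]) (use assms in auto)

section \<open>Gaussian integrals over the half line\<close>

lemma gaussian_half_integral:
  fixes \<alpha> :: real
  assumes "\<alpha> > 0"
  shows "has_bochner_integral lborel (\<lambda>t. indicator {0..} t *\<^sub>R exp (- (\<alpha> * t\<^sup>2))) (sqrt (pi / \<alpha>) / 2)"
proof -
  have "has_bochner_integral lborel (\<lambda>t. indicator {0..} (0 + sqrt \<alpha> * t) *\<^sub>R exp (- (0 + sqrt \<alpha> * t)\<^sup>2))
          ((sqrt pi / 2) /\<^sub>R \<bar>sqrt \<alpha>\<bar>)"
    using assms by (intro lborel_has_bochner_integral_real_affine_iff[THEN iffD1] gaussian_moment_0) auto
  moreover have "indicator {0..} (0 + sqrt \<alpha> * t) *\<^sub>R exp (- (0 + sqrt \<alpha> * t)\<^sup>2)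
       = indicator {0..} t *\<^sub>R exp (- (\<alpha> * t\<^sup>2))" for t
    using assms by (simp add: power_mult_distrib indicator_def zero_le_mult_iff)
  moreover have "(sqrt pi / 2) /\<^sub>R \<bar>sqrt \<alpha>\<bar> = sqrt (pi / \<alpha>) / 2"
    using assms by (simp add: real_sqrt_divide field_simps)
  ultimately show ?thesis by simp
qed

text \<open>For t > \<delta>, half of the exponent n \<beta> t^2 is at least n \<beta> \<delta>^2 /
  2 and is pulled out; the other half is integrated over the half line.\<close>

lemma gaussian_truncation:
  fixes \<beta> \<delta> :: real
  assumes "\<beta> > 0" "\<delta> > 0" "n > 0"
  shows "\<bar>integral {0..\<delta>} (\<lambda>t. exp (- (n * t\<^sup>2 * \<beta>))) - sqrt (pi / (n * \<beta>)) / 2\<bar>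
           \<le> exp (- (\<delta>\<^sup>2 * \<beta> / 2 * n)) * sqrt (pi / (n * \<beta> / 2)) / 2"
proof -
  define f where "f t = exp (- (n * \<beta> * t\<^sup>2))" for t :: real
  define f2 where "f2 t = exp (- (n * \<beta> / 2 * t\<^sup>2))" for t :: real
  have hb: "has_bochner_integral lborel (\<lambda>t. indicator {0..} t *\<^sub>R f t) (sqrt (pi / (n * \<beta>)) / 2)"
    unfolding f_def using assms by (intro gaussian_half_integral) auto
  have hb2: "has_bochner_integral lborel (\<lambda>t. indicator {0..} t *\<^sub>R f2 t) (sqrt (pi / (n * \<beta> / 2)) / 2)"
    unfolding f2_def using assms by (intro gaussian_half_integral) auto
  have si: "set_integrable lborel {0..} f"
    using hb unfolding set_integrable_def by (rule integrable.intros)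
  have si1: "set_integrable lborel {0..\<delta>} f" by (rule set_integrable_subset[OF si]) auto
  have si2: "set_integrable lborel {\<delta><..} f" by (rule set_integrable_subset[OF si]) (use assms in auto)
  have "{0..} = {0..\<delta>} \<union> {\<delta><..}" using assms by auto
  hence "set_lebesgue_integral lborel {0..} f
      = set_lebesgue_integral lborel {0..\<delta>} f + set_lebesgue_integral lborel {\<delta><..} f"
    using set_integral_Un[OF _ si1 si2] by (simp add: greaterThan_def atLeastAtMost_def disjoint_iff)
  moreover have "set_lebesgue_integral lborel {0..} f = sqrt (pi / (n * \<beta>)) / 2"
    using hb unfolding set_lebesgue_integral_def by (rule has_bochner_integral_integral_eq)
  moreover have "set_lebesgue_integral lborel {0..\<delta>} f = integral {0..\<delta>} f"
    using si1 by (rule set_borel_integral_eq_integral)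
  moreover have "set_lebesgue_integral lborel {\<delta><..} f \<ge> 0"
    unfolding set_lebesgue_integral_def f_def by (intro integral_nonneg_AE) auto
  moreover have "set_lebesgue_integral lborel {\<delta><..} f \<le> (\<integral>t. exp (- (\<delta>\<^sup>2 * \<beta> / 2 * n)) * (indicator {0..} t *\<^sub>R f2 t) \<partial>lborel)"
    unfolding set_lebesgue_integral_def
  proof (rule integral_mono)
    show "integrable lborel (\<lambda>t. indicator {\<delta><..} t *\<^sub>R f t)"
      using si2 unfolding set_integrable_def .
    show "integrable lborel (\<lambda>t. exp (- (\<delta>\<^sup>2 * \<beta> / 2 * n)) * (indicator {0..} t *\<^sub>R f2 t))"
      using hb2 by (intro integrable_mult_right) (auto simp: has_bochner_integral_iff)
    fix t :: real
    show "indicator {\<delta><..} t *\<^sub>R f t \<le> exp (- (\<delta>\<^sup>2 * \<beta> / 2 * n)) * (indicator {0..} t *\<^sub>R f2 t)"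
    proof (cases "t > \<delta>")
      case True
      have "\<delta>\<^sup>2 * (n * \<beta>) \<le> t\<^sup>2 * (n * \<beta>)"
        using True assms by (intro mult_right_mono power_mono) auto
      hence "f t \<le> exp (- (\<delta>\<^sup>2 * \<beta> / 2 * n)) * f2 t"
        unfolding f_def f2_def exp_add [symmetric] by (simp add: algebra_simps)
      thus ?thesis using True assms by simp
    qed (auto simp: f2_def)
  qed
  moreover have "(\<integral>t. exp (- (\<delta>\<^sup>2 * \<beta> / 2 * n)) * (indicator {0..} t *\<^sub>R f2 t) \<partial>lborel)
      = exp (- (\<delta>\<^sup>2 * \<beta> / 2 * n)) * (sqrt (pi / (n * \<beta> / 2)) / 2)"
    using has_bochner_integral_integral_eq[OF hb2] by simp
  moreover have "(\<lambda>t. exp (- (n * t\<^sup>2 * \<beta>))) = f" unfolding f_def by (simp add: mult_ac)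
  ultimately show ?thesis by (simp only:)
qed

text \<open>The integral of exp (- \<beta> t^2) t^l over the half line. The double factorial takes
  an integer argument, so l = 0 refers to (-1)!! = 1.\<close>

definition gaussian_moment :: "real \<Rightarrow> nat \<Rightarrow> complex" where
  "gaussian_moment \<beta> l = of_nat (dfact (int l - 1)) / of_real (2 * \<beta>) ^ (l div 2)
      * of_real (if even l then sqrt (pi / \<beta>) / 2 else 1 / (2 * \<beta>))"

lemma gaussian_moments:
  fixes \<beta> \<delta> :: real
  assumes "\<delta> > 0" "\<beta> > 0"
  shows "(\<lambda>n. integral {0..\<delta>} (\<lambda>t. exp (- (of_real (n * t ^ 2) * of_real \<beta>)) * of_real (t ^ l))
           - gaussian_moment \<beta> l * of_real (n powr (- real (l + 1) / real 2))) \<in> powr_O e"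
proof (rule moment_expansion[where \<mu> = "gaussian_moment \<beta>"])
  show "gaussian_moment \<beta> (2 - 1) = 1 / (of_nat 2 * of_real \<beta>)"
    by (simp add: gaussian_moment_def dfact.simps[of 0])
  show "gaussian_moment \<beta> (l + 2) = of_nat (l + 1) / (of_nat 2 * of_real \<beta>) * gaussian_moment \<beta> l" for l
    using assms by (simp add: gaussian_moment_def dfact.simps[of "1 + int l"] nat_add_distrib algebra_simps)
  fix l e assume "l < 2 - (1::nat)"
  hence l: "l = 0" by simp
  \<comment> \<open>The recursion in steps of 2 starts at index 1; the even chain needs its own
    start, the half Gaussian integral.\<close>
  define D where "D n = integral {0..\<delta>} (\<lambda>t. exp (- (n * t\<^sup>2 * \<beta>))) - sqrt (pi / (n * \<beta>)) / 2" for n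
  have "(\<lambda>n. of_real (D n)) \<in> powr_O e"
  proof (rule powr_O_exp[of _ "sqrt (pi / (\<beta> / 2)) / 2" "\<delta>\<^sup>2 * \<beta> / 2"])
    show "eventually (\<lambda>n. cmod (of_real (D n)) \<le> sqrt (pi / (\<beta> / 2)) / 2 * exp (- (\<delta>\<^sup>2 * \<beta> / 2 * n))) at_top"
      using eventually_ge_at_top[of 1]
    proof eventually_elim
      case (elim n)
      have "\<bar>D n\<bar> \<le> exp (- (\<delta>\<^sup>2 * \<beta> / 2 * n)) * (sqrt (pi / (n * \<beta> / 2)) / 2)"
        using gaussian_truncation[of \<beta> \<delta> n] assms elim unfolding D_def by simp
      also have "\<dots> \<le> exp (- (\<delta>\<^sup>2 * \<beta> / 2 * n)) * (sqrt (pi / (\<beta> / 2)) / 2)"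
        using assms elim by (intro mult_left_mono divide_right_mono real_sqrt_le_mono divide_left_mono) auto
      finally show ?case by (simp add: mult_ac)
    qed
  qed (use assms in auto)
  moreover have "eventually (\<lambda>n. of_real (D n) =
       integral {0..\<delta>} (\<lambda>t. exp (- (of_real (n * t ^ 2) * of_real \<beta>)) * of_real (t ^ l))
           - gaussian_moment \<beta> l * complex_of_real (n powr (- real (l + 1) / real 2))) at_top"
    using eventually_gt_at_top[of 0]
  proof eventually_elim
    case (elim n)
    have "integral {0..\<delta>} (\<lambda>t. exp (- (complex_of_real (n * t ^ 2) * of_real \<beta>)) * of_real (t ^ l))
        = of_real (integral {0..\<delta>} (\<lambda>t. exp (- (n * t\<^sup>2 * \<beta>))))"
    proof -
      have "exp (- (complex_of_real (n * t ^ 2) * of_real \<beta>)) * of_real (t ^ l)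
          = of_real (exp (- (n * t ^ 2 * \<beta>)))" for t
        unfolding l by (simp only: of_real_mult of_real_minus exp_of_real [symmetric] power_0 of_real_1 mult_1_right)
      thus ?thesis by (simp only: integral_of_real_continuous continuous_intros)
    qed
    moreover have "sqrt (pi / (n * \<beta>)) / 2 = sqrt (pi / \<beta>) / 2 * n powr (- 1 / 2)"
      using elim assms by (simp add: powr_minus_divide powr_half_sqrt real_sqrt_divide real_sqrt_mult)
    ultimately show ?case
      by (simp add: D_def gaussian_moment_def l dfact.simps[of "-1"])
  qed
  ultimately show "(\<lambda>n. integral {0..\<delta>} (\<lambda>t. exp (- (of_real (n * t ^ 2) * of_real \<beta>)) * of_real (t ^ l))
           - gaussian_moment \<beta> l * of_real (n powr (- real (l + 1) / real 2))) \<in> powr_O e"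
    by (rule powr_O_cong)
qed (use assms in auto)

section \<open>Expansion along a ray issuing from 1\<close>

text \<open>Removing the first M coefficients leaves x^M times the sum of the shifted series, which
  is continuous and hence bounded near 0.\<close>

lemma has_fps_expansion_taylor_bound:
  fixes f :: "complex \<Rightarrow> complex"
  assumes "f has_fps_expansion F"
  shows "\<exists>C. eventually (\<lambda>x. cmod (f x - (\<Sum>r<M. fps_nth F r * x ^ r)) \<le> C * cmod x ^ M) (nhds 0)"
proof -
  define g where "g = eval_fps (fps_shift M F)"
  have "fps_conv_radius F > 0" using assms by (simp add: has_fps_expansion_def)
  hence g: "g has_fps_expansion fps_shift M F"
    unfolding g_def by (intro eval_fps_has_fps_expansion) simp
  have "(\<lambda>x. (\<Sum>r<M. fps_nth F r * x ^ r) + g x * x ^ M) has_fps_expansion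
          ((\<Sum>r<M. fps_const (fps_nth F r) * fps_X ^ r) + fps_shift M F * fps_X ^ M)"
    by (intro has_fps_expansion_add has_fps_expansion_sum has_fps_expansion_cmult_left
          has_fps_expansion_fps_X_power has_fps_expansion_mult g)
  also have "(\<Sum>r<M. fps_const (fps_nth F r) * fps_X ^ r) = fps_cutoff M F"
    by (rule fps_ext) (auto simp: fps_sum_nth fps_X_power_nth if_distrib [of "\<lambda>x. _ * x"] cong: if_cong)
  also have "fps_cutoff M F + fps_shift M F * fps_X ^ M = F"
    by (subst add.commute) (rule fps_shift_cutoff)
  finally have F': "(\<lambda>x. (\<Sum>r<M. fps_nth F r * x ^ r) + g x * x ^ M) has_fps_expansion F" .
  have "isCont g 0"
    using has_fps_expansion_imp_continuous[OF g, of UNIV] by simp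
  hence "eventually (\<lambda>x. dist (g x) (g 0) < 1) (nhds 0)"
    unfolding continuous_at by (intro tendstoD) (auto simp: tendsto_at_iff_tendsto_nhds)
  moreover have "eventually (\<lambda>x. f x = (\<Sum>r<M. fps_nth F r * x ^ r) + g x * x ^ M) (nhds 0)"
    using assms[unfolded has_fps_expansion_def, THEN conjunct2] F'[unfolded has_fps_expansion_def, THEN conjunct2]
    by eventually_elim simp
  ultimately have "eventually (\<lambda>x. cmod (f x - (\<Sum>r<M. fps_nth F r * x ^ r)) \<le> (cmod (g 0) + 1) * cmod x ^ M) (nhds 0)"
  proof eventually_elim
    case (elim x)
    have "cmod (g x) \<le> cmod (g 0) + 1"
      using elim(1) norm_triangle_ineq2[of "g x" "g 0"] by (simp add: dist_norm)
    thus ?case unfolding elim(2) by (simp add: norm_mult norm_power mult_right_mono)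
  qed
  thus ?thesis by blast
qed

text \<open>The tail of the series of -Ln (1 - x) beyond degree p, divided by x^p. Its coefficients
  1/(p+1), 1/(p+2), ... are \<open>seq2\<close> for p = 1 and \<open>seq3\<close> for p = 2. The
  value 0 at x = 0 is the limit, so the power series represents it there too.\<close>

definition log_remainder :: "nat \<Rightarrow> complex \<Rightarrow> complex" where
  "log_remainder p x = (if x = 0 then 0 else - (Ln (1 - x) + (\<Sum>j=1..p. x ^ j / of_nat j)) / x ^ p)"

definition log_remainder_fps :: "nat \<Rightarrow> complex fps" where
  "log_remainder_fps p = Abs_fps (\<lambda>j. if j = 0 then 0 else 1 / of_nat (j + p))"

lemma Ln_eq_log_remainder: "Ln (1 - x) = - (\<Sum>j=1..p. x ^ j / of_nat j) - x ^ p * log_remainder p x"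
  by (auto simp: log_remainder_def intro!: sum.neutral)

lemma log_remainder_has_fps_expansion: "log_remainder p has_fps_expansion log_remainder_fps p"
proof (rule has_fps_expansionI)
  have "eventually (\<lambda>u::complex. u \<in> ball 0 1) (nhds 0)"
    by (intro eventually_nhds_in_open) auto
  thus "eventually (\<lambda>u. (\<lambda>n. fps_nth (log_remainder_fps p) n * u ^ n) sums log_remainder p u) (nhds 0)"
  proof eventually_elim
    case (elim u)
    show ?case
    proof (cases "u = 0")
      case True
      have "(\<lambda>n. fps_nth (log_remainder_fps p) n * u ^ n) = (\<lambda>n. 0)"
        by (auto simp: log_remainder_fps_def True)
      thus ?thesis by (simp add: log_remainder_def True)
    next
      case False
      have "(\<lambda>n. - (- (u ^ n) / of_nat n)) sums - Ln (1 - u)"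
        using elim Ln_series'[of "- u"] by (intro sums_minus) simp
      hence "(\<lambda>n. u ^ n / of_nat n) sums - Ln (1 - u)" by simp
      from sums_split_initial_segment[OF this, of "Suc p"]
      have "(\<lambda>n. u ^ (n + Suc p) / of_nat (n + Suc p)) sums (- Ln (1 - u) - (\<Sum>j<Suc p. u ^ j / of_nat j))" .
      from sums_divide[OF this, of "u ^ p"]
      have "(\<lambda>n. u ^ (n + Suc p) / of_nat (n + Suc p) / u ^ p)
              sums ((- Ln (1 - u) - (\<Sum>j<Suc p. u ^ j / of_nat j)) / u ^ p)" .
      \<comment> \<open>The term j = 0 is u^0 / 0 = 0, so discarding p + 1 terms removes exactly the
        polynomial of degree p.\<close>
      moreover have "(\<Sum>j<Suc p. u ^ j / of_nat j) = (\<Sum>j=1..p. u ^ j / of_nat j)"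
        by (intro sum.mono_neutral_right) auto
      moreover have "u ^ (n + Suc p) / of_nat (n + Suc p) / u ^ p = fps_nth (log_remainder_fps p) (Suc n) * u ^ Suc n" for n
        using False by (simp add: log_remainder_fps_def power_add add_ac)
      ultimately have "(\<lambda>n. fps_nth (log_remainder_fps p) (Suc n) * u ^ Suc n) sums log_remainder p u"
        using False by (simp add: log_remainder_def algebra_simps)
      from sums_Suc[OF this] show ?thesis by (simp add: log_remainder_fps_def)
    qed
  qed
qed

definition one_minus_powr_fps :: "complex \<Rightarrow> complex fps" where
  "one_minus_powr_fps v = Abs_fps (\<lambda>j. (-1) ^ j * (v gchoose j))"

lemma one_minus_powr_has_fps_expansion: "(\<lambda>x. (1 - x) powr v) has_fps_expansion one_minus_powr_fps v"
proof (rule has_fps_expansionI)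
  have "eventually (\<lambda>u::complex. u \<in> ball 0 1) (nhds 0)"
    by (intro eventually_nhds_in_open) auto
  thus "eventually (\<lambda>u. (\<lambda>n. fps_nth (one_minus_powr_fps v) n * u ^ n) sums (1 - u) powr v) (nhds 0)"
  proof eventually_elim
    case (elim u)
    have "(\<lambda>n. (v gchoose n) * (- u) ^ n) sums (1 + - u) powr v"
      using elim by (intro gen_binomial_complex) simp
    moreover have "(v gchoose n) * (- u) ^ n = fps_nth (one_minus_powr_fps v) n * u ^ n" for n
      by (simp add: one_minus_powr_fps_def power_minus[of u])
    ultimately show ?case by simp
  qed
qed

text \<open>The Taylor coefficients that enter Laplace's method: k is the index in the exponential
  series, and the binomial factor comes from z^v. Written out as Cauchy products they become the De
  Moivre sums of the coefficients.\<close>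

definition phase_coeff :: "nat \<Rightarrow> complex \<Rightarrow> nat \<Rightarrow> nat \<Rightarrow> complex" where
  "phase_coeff p v k r = fps_nth (log_remainder_fps p ^ k * one_minus_powr_fps v) r"

text \<open>The remainder series has no constant term, so its k-th power starts at degree k. For k =
  M this is the assumption \<open>cM\<close> of \<open>laplace_expansion\<close>.\<close>

lemma phase_coeff_eq_0: "r < k \<Longrightarrow> phase_coeff p v k r = 0"
  unfolding phase_coeff_def fps_mult_nth
  by (intro sum.neutral) (auto simp: startsby_zero_power_prefix log_remainder_fps_def)

lemma phase_taylor_bound:
  "\<exists>C. eventually (\<lambda>x. cmod (log_remainder p x ^ k * (1 - x) powr v - (\<Sum>r<M. phase_coeff p v k r * x ^ r))
                     \<le> C * cmod x ^ M) (nhds 0)"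
  unfolding phase_coeff_def
  by (intro has_fps_expansion_taylor_bound has_fps_expansion_mult has_fps_expansion_power log_remainder_has_fps_expansion
        one_minus_powr_has_fps_expansion)

text \<open>The integrand is that of \<open>S_n\<close> along the ray \<open>z = 1 - u t\<close>. The hypothesis \<open>phase\<close> covers the
  two cases \<open>p = 1\<close>, \<open>b = (1 - w) u\<close> and \<open>p = 2\<close>, \<open>w = 1\<close>, \<open>u = \<plusminus>1\<close>, \<open>b = 1/2\<close>.\<close>

lemma ray_expansion:
  fixes p M :: nat and u w v b :: complex and \<mu> :: "nat \<Rightarrow> complex"
  assumes p: "p \<ge> 1" and M: "M \<ge> 1" and b: "Re b > 0"
    and phase: "\<And>t. w * u * of_real t - (\<Sum>j=1..p. (u * of_real t) ^ j / of_nat j) = - b * of_real (t ^ p)"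
    and moment: "\<And>\<delta> l e. \<delta> > 0 \<Longrightarrow>
          (\<lambda>n. integral {0..\<delta>} (\<lambda>t. exp (- (of_real (n * t ^ p) * b)) * of_real (t ^ l))
                        - \<mu> l * of_real (n powr (- real (l + 1) / real p))) \<in> powr_O e"
    and moment_bound: "\<And>\<delta> l. \<delta> > 0 \<Longrightarrow>
          (\<lambda>n. of_real (integral {0..\<delta>} (\<lambda>t. exp (- (n * t ^ p * (Re b / 2))) * t ^ l)))
             \<in> powr_O (- real (l + 1) / real p)"
  obtains \<delta>\<^sub>0 where "\<delta>\<^sub>0 > 0" "\<And>\<delta>. 0 < \<delta> \<Longrightarrow> \<delta> \<le> \<delta>\<^sub>0 \<Longrightarrow>
      (\<lambda>n. integral {0..\<delta>} (\<lambda>t. exp (of_real n * w * (u * of_real t)) * (1 - u * of_real t) powr (of_real n + v))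
           - (\<Sum>r<M. of_real (n powr (- real (r + 1) / real p)) *
                (\<Sum>k<M. (- (u ^ p)) ^ k * u ^ r * phase_coeff p v k r / fact k * \<mu> (p * k + r))))
         \<in> powr_O (- real (M + 1) / real p)"
proof -
  define L where "L = log_remainder p"
  have L: "L has_fps_expansion log_remainder_fps p"
    unfolding L_def by (rule log_remainder_has_fps_expansion)
  have "\<forall>k. \<exists>C. eventually (\<lambda>x. cmod (L x ^ k * (1 - x) powr v - (\<Sum>r<M. phase_coeff p v k r * x ^ r)) \<le> C * cmod x ^ M) (nhds 0)"
    unfolding L_def using phase_taylor_bound by blast
  then obtain C where C: "\<And>k. eventually (\<lambda>x. cmod (L x ^ k * (1 - x) powr v - (\<Sum>r<M. phase_coeff p v k r * x ^ r)) \<le> C k * cmod x ^ M) (nhds 0)"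
    unfolding choice_iff by blast
  have ev1: "eventually (\<lambda>x. \<forall>k\<in>{..M}. cmod (L x ^ k * (1 - x) powr v - (\<Sum>r<M. phase_coeff p v k r * x ^ r)) \<le> C k * cmod x ^ M) (nhds 0)"
    using C by (intro eventually_ball_finite) auto
  have "((\<lambda>x. cmod (u ^ p * L x)) \<longlongrightarrow> cmod (u ^ p * L 0)) (nhds 0)"
    using has_fps_expansion_imp_continuous[OF L, of UNIV]
    by (intro tendsto_intros) (simp add: continuous_at tendsto_at_iff_tendsto_nhds)
  \<comment> \<open>The remainder vanishes at 0, so near 0 the correction uses up at most half of
    the decay rate Re b; hence \<beta> = Re b / 2 below.\<close>
  hence ev2: "eventually (\<lambda>x. cmod (u ^ p * L x) < Re b / 2) (nhds 0)"
    by (rule order_tendstoD) (use b in \<open>simp add: L_def log_remainder_def\<close>)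
  obtain s where s: "open s" "0 \<in> s" "L holomorphic_on s"
    by (rule has_fps_expansion_imp_holomorphic[OF L])
  \<comment> \<open>The set \<open>s\<close> provides continuity of \<open>L\<close>; the unit ball
    keeps Re (1 - x) positive, away from the branch cut.\<close>
  have ev3: "eventually (\<lambda>x. x \<in> s \<inter> ball 0 1) (nhds 0)"
    using s by (intro eventually_nhds_in_open) auto
  obtain d where d: "d > 0" and dist_d: "\<And>x. dist x 0 < d \<Longrightarrow>
      (\<forall>k\<in>{..M}. cmod (L x ^ k * (1 - x) powr v - (\<Sum>r<M. phase_coeff p v k r * x ^ r)) \<le> C k * cmod x ^ M)
      \<and> cmod (u ^ p * L x) < Re b / 2 \<and> x \<in> s \<inter> ball 0 1"
    using eventually_conj[OF ev1 eventually_conj[OF ev2 ev3]] unfolding eventually_nhds_metric by blast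
  \<comment> \<open>Makes |u t| \<le> d / 2 for all t \<le> \<open>\<delta>\<^sub>0\<close>; the
    added 1 keeps the denominator positive whatever u is.\<close>
  define \<delta>\<^sub>0 where "\<delta>\<^sub>0 = d / (2 * (cmod u + 1))"
  have "\<delta>\<^sub>0 > 0" unfolding \<delta>\<^sub>0_def using d by (simp add: add_nonneg_pos)
  moreover have "(\<lambda>n. integral {0..\<delta>} (\<lambda>t. exp (of_real n * w * (u * of_real t)) * (1 - u * of_real t) powr (of_real n + v))
           - (\<Sum>r<M. of_real (n powr (- real (r + 1) / real p)) *
                (\<Sum>k<M. (- (u ^ p)) ^ k * u ^ r * phase_coeff p v k r / fact k * \<mu> (p * k + r))))
         \<in> powr_O (- real (M + 1) / real p)" if \<delta>: "0 < \<delta>" "\<delta> \<le> \<delta>\<^sub>0" for \<delta>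
  proof -
    have dist: "dist (u * of_real t) 0 < d" if t: "t \<in> {0..\<delta>}" for t
    proof -
      have "cmod (u * of_real t) \<le> (cmod u + 1) * \<delta>\<^sub>0"
        unfolding norm_mult using t \<delta> by (intro mult_mono) auto
      also have "(cmod u + 1) * \<delta>\<^sub>0 = d / 2"
      proof -
        have h: "c * (d / (2 * c)) = d / 2" if "c \<noteq> 0" for c :: real using that by simp
        show ?thesis unfolding \<delta>\<^sub>0_def by (rule h) (use norm_ge_zero[of u] in linarith)
      qed
      finally show ?thesis using d by simp
    qed
    note near = dist_d[OF dist]
    \<comment> \<open>With x = u t, the term - x^p L(x) of Ln (1 - x) equals t^p times
      \<open>Q t\<close>.\<close>
    define Q where "Q t = - (u ^ p) * L (u * of_real t)" for t :: real
    define g where "g t = (1 - u * of_real t) powr v" for t :: real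
    have Re_pos: "Re (1 - u * of_real t) > 0" if "t \<in> {0..\<delta>}" for t
    proof -
      have "cmod (u * of_real t) < 1" using near[OF that] by simp
      thus ?thesis using complex_Re_le_cmod[of "u * of_real t"] by simp
    qed
    have contL: "continuous_on s L" using s(3) by (rule holomorphic_on_imp_continuous_on)
    have "continuous_on {0..\<delta>} (\<lambda>t. L (u * of_real t))"
      by (rule continuous_on_compose2[OF contL]) (use near in \<open>auto intro!: continuous_intros\<close>)
    hence contQ: "continuous_on {0..\<delta>} Q"
      unfolding Q_def by (intro continuous_on_mult continuous_on_const)
    have contg: "continuous_on {0..\<delta>} g"
      unfolding g_def
    proof (intro continuous_on_powr_complex)
      show "{0..\<delta>} \<subseteq> {t. Re (1 - u * of_real t) \<ge> 0 \<or> Im (1 - u * of_real t) \<noteq> 0}"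
        using Re_pos by (auto intro: less_imp_le)
      show "Re v > 0" if "t \<in> {0..\<delta>}" "1 - u * of_real t = 0" for t
        using Re_pos[OF that(1)] unfolding that(2) by simp
    qed (intro continuous_intros)+
    have "(\<lambda>n. integral {0..\<delta>} (\<lambda>t. exp (of_real n * (- b * of_real (t ^ p) + of_real (t ^ p) * Q t)) * g t)
           - (\<Sum>r<M. of_real (n powr (- real (r + 1) / real p)) *
                (\<Sum>k<M. (- (u ^ p)) ^ k * u ^ r * phase_coeff p v k r / fact k * \<mu> (p * k + r))))
         \<in> powr_O (- real (M + 1) / real p)"
    proof (rule laplace_expansion[where \<beta> = "Re b / 2"])
      show "cmod (Q t) \<le> Re b - Re b / 2" if "t \<in> {0..\<delta>}" for t
        using near[OF that] by (simp add: Q_def norm_mult)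
      show "\<exists>C. \<forall>t\<in>{0..\<delta>}. cmod (Q t ^ k * g t - (\<Sum>r<M. (- (u ^ p)) ^ k * u ^ r * phase_coeff p v k r * of_real (t ^ r))) \<le> C * t ^ M"
        if k: "k \<le> M" for k
      proof (intro exI ballI)
        fix t assume t: "t \<in> {0..\<delta>}"
        define x where "x = u * complex_of_real t"
        have "Q t ^ k * g t - (\<Sum>r<M. (- (u ^ p)) ^ k * u ^ r * phase_coeff p v k r * of_real (t ^ r))
            = (- (u ^ p)) ^ k * (L x ^ k * (1 - x) powr v - (\<Sum>r<M. phase_coeff p v k r * x ^ r))"
          unfolding right_diff_distrib sum_distrib_left Q_def g_def x_def power_mult_distrib of_real_power
          by (simp add: mult_ac)
        hence "cmod (Q t ^ k * g t - (\<Sum>r<M. (- (u ^ p)) ^ k * u ^ r * phase_coeff p v k r * of_real (t ^ r)))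
            = cmod ((- (u ^ p)) ^ k) * cmod (L x ^ k * (1 - x) powr v - (\<Sum>r<M. phase_coeff p v k r * x ^ r))"
          by (simp only: norm_mult)
        also have "\<dots> \<le> cmod ((- (u ^ p)) ^ k) * (C k * cmod x ^ M)"
          using near[OF t] k unfolding x_def by (intro mult_left_mono) auto
        also have "\<dots> = cmod ((- (u ^ p)) ^ k) * C k * cmod u ^ M * t ^ M"
          using t by (simp add: x_def norm_mult power_mult_distrib mult_ac)
        finally show "cmod (Q t ^ k * g t - (\<Sum>r<M. (- (u ^ p)) ^ k * u ^ r * phase_coeff p v k r * of_real (t ^ r))) \<le> \<dots>" .
      qed
      show "(- (u ^ p)) ^ M * u ^ r * phase_coeff p v M r = 0" if "r < M" for r
        using phase_coeff_eq_0[OF that] by simp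
    qed (rule p M \<delta> contQ contg moment moment_bound)+
    moreover have "exp (of_real n * (- b * of_real (t ^ p) + of_real (t ^ p) * Q t)) * g t
        = exp (of_real n * w * (u * of_real t)) * (1 - u * of_real t) powr (of_real n + v)"
      if t: "t \<in> {0..\<delta>}" for n t
    proof -
      define x where "x = u * complex_of_real t"
      have "1 - x \<noteq> 0" using Re_pos[OF t] unfolding x_def [symmetric] by auto
      hence "(1 - x) powr (of_real n + v) = exp (of_real n * Ln (1 - x)) * (1 - x) powr v"
        by (simp add: powr_def ring_distribs exp_add mult_ac)
      moreover have "- b * of_real (t ^ p) + of_real (t ^ p) * Q t = w * x + Ln (1 - x)"
        unfolding phase [symmetric] Ln_eq_log_remainder[of x p] Q_def L_def [symmetric]
        by (simp add: x_def power_mult_distrib algebra_simps)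
      ultimately show ?thesis
        unfolding g_def x_def [symmetric] by (simp add: exp_add [symmetric] ring_distribs mult_ac)
    qed
    hence "integral {0..\<delta>} (\<lambda>t. exp (of_real n * (- b * of_real (t ^ p) + of_real (t ^ p) * Q t)) * g t)
       = integral {0..\<delta>} (\<lambda>t. exp (of_real n * w * (u * of_real t)) * (1 - u * of_real t) powr (of_real n + v))" for n
      by (intro integral_cong)
    ultimately show ?thesis by (simp only:)
  qed
  ultimately show ?thesis by (rule that)
qed

section \<open>Euler's integral with a complex scale\<close>

lemma powr_mult_exp_tendsto_0:
  fixes a m :: real
  assumes "m > 0"
  shows "((\<lambda>N. N powr a * exp (- (m * N))) \<longlongrightarrow> 0) at_top"
  using assms by real_asymp

lemma continuous_on_of_real_powr:
  assumes "Re a > 0"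
  shows "continuous_on {0..N} (\<lambda>t. complex_of_real t powr a)"
  using assms by (intro continuous_on_powr_complex) (auto intro!: continuous_intros)

text \<open>Differentiation under the integral turns G into -H, where H has one more factor t.
  Integration by parts rewrites W H as s G minus a boundary term at N, and the s G terms cancel
  against the derivative of W^s.\<close>

lemma truncated_Gamma_integral_derivative:
  fixes s W :: complex and N :: real
  assumes s: "Re s > 1" and N: "N > 0" and W: "Re W > 0"
  defines "G \<equiv> \<lambda>W. integral {0..N} (\<lambda>t. exp (- (W * of_real t)) * of_real t powr (s - 1))"
  shows "((\<lambda>W. exp (s * Ln W) * G W) has_field_derivative
           exp (s * Ln W) / W * (of_real N powr s * exp (- (W * of_real N)))) (at W)"
proof -
  define U where "U = {W::complex. Re W > 0}"
  have U: "open U" "convex U" "W \<in> U"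
    unfolding U_def using W by (auto simp: open_halfspace_Re_gt convex_halfspace_Re_gt)
  have W0: "W \<noteq> 0" "W \<notin> \<real>\<^sub>\<le>\<^sub>0" using W by (auto simp: complex_nonpos_Reals_iff)
  have int1: "continuous_on {0..N} (\<lambda>t. exp (- (W * of_real t)) * of_real t powr (s - 1))" for W
    using s by (intro continuous_on_mult continuous_intros continuous_on_of_real_powr) auto
  have int2: "continuous_on {0..N} (\<lambda>t. exp (- (W * of_real t)) * of_real t powr s)" for W
    using s by (intro continuous_on_mult continuous_intros continuous_on_of_real_powr) auto
  define H where "H W = integral {0..N} (\<lambda>t. exp (- (W * of_real t)) * of_real t powr s)" for W
  have powr_Suc: "of_real t * of_real t powr (s - 1) = complex_of_real t powr s" for t
    by (simp add: powr_diff)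
  have "((\<lambda>W. integral (cbox 0 N) (\<lambda>t. exp (- (W * of_real t)) * of_real t powr (s - 1))) has_field_derivative
          integral (cbox 0 N) (\<lambda>t. - (exp (- (W * of_real t)) * of_real t powr s))) (at W within U)"
  proof (rule leibniz_rule_field_derivative)
    show "((\<lambda>W. exp (- (W * of_real t)) * of_real t powr (s - 1)) has_field_derivative
             - (exp (- (W * of_real t)) * of_real t powr s)) (at W within U)" for W t
      unfolding powr_Suc [symmetric] by (auto intro!: derivative_eq_intros)
    show "(\<lambda>t. exp (- (W * of_real t)) * of_real t powr (s - 1)) integrable_on cbox 0 N" for W
      using int1 by (intro integrable_continuous) simp
    show "continuous_on (U \<times> cbox 0 N) (\<lambda>(W, t). - (exp (- (W * of_real t)) * of_real t powr s))"
      unfolding case_prod_unfold using s by (intro continuous_intros) auto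
  qed (use U in auto)
  hence dG: "(G has_field_derivative - H W) (at W)"
    unfolding G_def H_def box_real integral_neg at_within_open[OF U(3) U(1)] .
  \<comment> \<open>Integration by parts. The derivative is taken only inside the interval, because
    0 lies on the branch cut of \<open>powr\<close>.\<close>
  have "((\<lambda>t. s * (exp (- (W * of_real t)) * of_real t powr (s - 1)) - W * (exp (- (W * of_real t)) * of_real t powr s))
      has_integral (exp (- (W * of_real N)) * of_real N powr s - exp (- (W * of_real 0)) * of_real 0 powr s)) {0..N}"
  proof (rule fundamental_theorem_of_calculus_interior)
    fix t assume t: "t \<in> {0<..<N}"
    have "((\<lambda>z. exp (- (W * z)) * z powr s) has_field_derivative
             s * (exp (- (W * of_real t)) * of_real t powr (s - 1)) - W * (exp (- (W * of_real t)) * of_real t powr s)) (at (of_real t))"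
      using t by (auto intro!: derivative_eq_intros has_field_derivative_powr simp: complex_nonpos_Reals_iff algebra_simps)
    thus "((\<lambda>t. exp (- (W * of_real t)) * of_real t powr s) has_vector_derivative
             s * (exp (- (W * of_real t)) * of_real t powr (s - 1)) - W * (exp (- (W * of_real t)) * of_real t powr s)) (at t)"
      by (rule has_vector_derivative_real_field)
  qed (use N int2 in auto)
  moreover have "((\<lambda>t. s * (exp (- (W * of_real t)) * of_real t powr (s - 1)) - W * (exp (- (W * of_real t)) * of_real t powr s))
      has_integral (s * G W - W * H W)) {0..N}"
    unfolding G_def H_def
    by (intro has_integral_diff has_integral_mult_right integrable_integral integrable_continuous_interval int1 int2)
  ultimately have eq: "s * G W - W * H W = exp (- (W * of_real N)) * of_real N powr s - exp (- (W * of_real 0)) * of_real 0 powr s"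
    by (rule has_integral_unique[rotated])
  have solve_H: "- h = (x - s * g) / W" if "s * g - W * h = x" for h x g
    unfolding that [symmetric] using W0(1) by simp
  have HW: "- H W = (of_real N powr s * exp (- (W * of_real N)) - s * G W) / W"
  proof -
    have "s * G W - W * H W = of_real N powr s * exp (- (W * of_real N))"
      using eq by (simp add: mult.commute)
    thus ?thesis by (rule solve_H)
  qed
  have "((\<lambda>W. exp (s * Ln W) * G W) has_field_derivative
           exp (s * Ln W) * (- H W) + exp (s * Ln W) * (s * (1 / W)) * G W) (at W)"
    using W0 by (auto intro!: derivative_eq_intros dG simp: divide_inverse mult_ac)
  also have "exp (s * Ln W) * (- H W) + exp (s * Ln W) * (s * (1 / W)) * G W
      = exp (s * Ln W) / W * (of_real N powr s * exp (- (W * of_real N)))"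
  proof -
    have "e * ((x - s * g) / W) + e * (s * (1 / W)) * g = e / W * x" for e x g
      by (simp add: divide_inverse algebra_simps)
    thus ?thesis unfolding HW .
  qed
  finally show ?thesis .
qed

text \<open>The scale W = 1, from which the other scales are reached by following the segment from 1
  to W.\<close>

lemma truncated_Gamma_integral_tendsto:
  assumes "Re s > 0"
  shows "((\<lambda>N. integral {0..N} (\<lambda>t. exp (- (complex_of_real t)) * of_real t powr (s - 1))) \<longlongrightarrow> Gamma s) at_top"
proof -
  define f where "f t = complex_of_real t powr (s - 1) / of_real (exp t)" for t
  have f_eq: "exp (- (complex_of_real t)) * of_real t powr (s - 1) = f t" for t
    unfolding f_def by (simp add: exp_minus exp_of_real field_simps)
  have "f absolutely_integrable_on {0<..}"
    unfolding f_def by (rule absolutely_integrable_Gamma_integral'[OF assms])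
  hence ai: "f absolutely_integrable_on {0..}"
    by (rule absolutely_integrable_spike_set) (auto intro: negligible_subset[of "{0}"])
  have "((\<lambda>N. set_lebesgue_integral lebesgue {0..N} f) \<longlongrightarrow> set_lebesgue_integral lebesgue {0..} f) at_top"
    by (rule tendsto_set_lebesgue_integral_at_top[OF _ ai]) auto
  moreover have "set_lebesgue_integral lebesgue {0..} f = Gamma s"
    unfolding set_lebesgue_integral_eq_integral(2)[OF ai] f_def
    by (rule integral_unique[OF Gamma_integral_complex[OF assms]])
  moreover have "set_lebesgue_integral lebesgue {0..N} f = integral {0..N} f" for N
    by (rule set_lebesgue_integral_eq_integral(2)) (rule set_integrable_subset[OF ai], auto)
  ultimately show ?thesis unfolding f_eq by simp
qed

text \<open>By the previous derivative, \<open>W^s\<close> times the truncated integral becomes independent of \<open>W\<close>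
  as \<open>N\<close> tends to infinity, uniformly on the segment from 1 to \<open>W\<close>.\<close>

lemma scaled_Gamma_integral_tendsto:
  assumes s: "Re s > 1" and W: "Re W > 0"
  shows "((\<lambda>N. integral {0..N} (\<lambda>t. exp (- (W * of_real t)) * of_real t powr (s - 1)))
            \<longlongrightarrow> exp (- s * Ln W) * Gamma s) at_top"
proof -
  define G where "G N W = integral {0..N} (\<lambda>t. exp (- (W * of_real t)) * of_real t powr (s - 1))" for N W
  define S where "S = closed_segment 1 W"
  \<comment> \<open>The least real part on the segment from 1 to W, which gives the uniform decay
    exp (- m N).\<close>
  define m where "m = min 1 (Re W)"
  have m: "m > 0" unfolding m_def using W by simp
  have "S \<subseteq> {z. Re z \<ge> m}"
    unfolding S_def by (rule closed_segment_subset) (auto simp: m_def convex_halfspace_Re_ge)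
  hence Re_S: "Re z \<ge> m" if "z \<in> S" for z
    using that by auto
  have pos: "Re z > 0" "z \<noteq> 0" "z \<notin> \<real>\<^sub>\<le>\<^sub>0" if "z \<in> S" for z
  proof -
    show "Re z > 0" using Re_S[OF that] m by linarith
    thus "z \<noteq> 0" "z \<notin> \<real>\<^sub>\<le>\<^sub>0" by (auto simp: complex_nonpos_Reals_iff)
  qed
  have cpt: "compact ((\<lambda>z. exp (s * Ln z) / z) ` S)"
    by (intro compact_continuous_image continuous_on_divide continuous_intros)
       (use pos in \<open>auto simp: S_def\<close>)
  obtain K where K: "K > 0" "\<forall>y\<in>(\<lambda>z. exp (s * Ln z) / z) ` S. cmod y \<le> K"
    using compact_imp_bounded[OF cpt] unfolding bounded_pos by (elim exE conjE) (rule that)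
  have bound: "cmod (exp (s * Ln W) * G N W - G N 1) \<le> K * (N powr Re s * exp (- (m * N))) * cmod (W - 1)"
    if N: "N > 0" for N
  proof -
    have "cmod (exp (s * Ln W) * G N W - exp (s * Ln 1) * G N 1) \<le> K * (N powr Re s * exp (- (m * N))) * cmod (W - 1)"
    proof (rule field_differentiable_bound[where S = S])
      fix z assume z: "z \<in> S"
      show "((\<lambda>W. exp (s * Ln W) * G N W) has_field_derivative
           exp (s * Ln z) / z * (of_real N powr s * exp (- (z * of_real N)))) (at z within S)"
        unfolding G_def
        by (rule has_field_derivative_at_within, rule truncated_Gamma_integral_derivative[OF s N pos(1)[OF z]])
      have "cmod (of_real N powr s * exp (- (z * of_real N))) = N powr Re s * exp (- (Re z * N))"
        using N by (simp add: norm_mult norm_powr_real_powr)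
      also have "\<dots> \<le> N powr Re s * exp (- (m * N))"
        using N Re_S[OF z] by (intro mult_left_mono) auto
      finally show "cmod (exp (s * Ln z) / z * (of_real N powr s * exp (- (z * of_real N))))
          \<le> K * (N powr Re s * exp (- (m * N)))"
        unfolding norm_mult[of "exp (s * Ln z) / z"]
        by (rule mult_mono[OF bspec[OF K(2) imageI[OF z]]]) (use K(1) in auto)
    next
      show "convex S" "W \<in> S" "1 \<in> S" by (simp_all add: S_def)
    qed
    thus ?thesis by simp
  qed
  have "((\<lambda>N. K * (N powr Re s * exp (- (m * N))) * cmod (W - 1)) \<longlongrightarrow> 0) at_top"
    by (intro tendsto_mult_left_zero tendsto_mult_right_zero powr_mult_exp_tendsto_0 m)
  hence "((\<lambda>N. exp (s * Ln W) * G N W - G N 1) \<longlongrightarrow> 0) at_top"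
    by (rule Lim_null_comparison[rotated]) (rule eventually_mono[OF eventually_gt_at_top[of 0] bound])
  moreover have "((\<lambda>N. G N 1) \<longlongrightarrow> Gamma s) at_top"
    using truncated_Gamma_integral_tendsto[of s] s unfolding G_def by simp
  ultimately have "((\<lambda>N. exp (- s * Ln W) * (exp (s * Ln W) * G N W - G N 1 + G N 1)) \<longlongrightarrow> exp (- s * Ln W) * (0 + Gamma s)) at_top"
    by (rule tendsto_mult[OF tendsto_const tendsto_add])
  moreover have "(\<lambda>N. exp (- s * Ln W) * (exp (s * Ln W) * G N W - G N 1 + G N 1)) = (\<lambda>N. G N W)"
    by (simp add: exp_minus field_simps)
  ultimately show ?thesis unfolding G_def by (simp only: add_0_left)
qed

section \<open>Localisation at 1\<close>

text \<open>The Jacobian of z = 1 - u t is left out, so path integrals appear, up to sign, as u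
  times a ray integral. Direction u = 1 leads from 1 to 0, direction u = -1 to infinity.\<close>

definition ray_integral :: "complex \<Rightarrow> complex \<Rightarrow> complex \<Rightarrow> real \<Rightarrow> real \<Rightarrow> complex" where
  "ray_integral u w v n \<delta> = integral {0..\<delta>}
     (\<lambda>t. exp (of_real n * w * (u * of_real t)) * (1 - u * of_real t) powr (of_real n + v))"

lemma S_fun_eq_ray_integral: "S_fun n w v = 1 + of_real n * w * ray_integral 1 w v n 1"
proof -
  define f where "f z = exp (of_real n * w * of_real (1 - z)) * (of_real z) powr (of_real n + v)" for z :: real
  have "integral {0..1} f = integral {- 1..0} (f \<circ> (+) 1)"
    by (subst integral_shift_Icc_real) simp
  also have "\<dots> = integral {0..1} (\<lambda>x. (f \<circ> (+) 1) (- x))"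
    using Henstock_Kurzweil_Integration.integral_reflect_real[of 1 0 "\<lambda>x. (f \<circ> (+) 1) (- x)"] by (simp add: o_def)
  also have "\<dots> = ray_integral 1 w v n 1"
    unfolding ray_integral_def f_def by (simp add: mult_ac)
  finally show ?thesis unfolding S_fun_def f_def by simp
qed

text \<open>With s = n + v + 1 and W = n w, Euler's integral identifies e^W W^(-s) Gamma(s) = (T_n +
  S_n) / W with e^W times an integral over the half line. The part over [0,1] is (S_n - 1) / W,
  which leaves (T_n + 1) / W from 1 to infinity.\<close>

lemma T_fun_ray_integral_tendsto:
  assumes n: "n > 0" and w: "Re w > 0" and nv: "Re (of_real n + v) > 0"
  shows "((\<lambda>N. ray_integral (- 1) w v n N) \<longlongrightarrow> (T_fun n w v + 1) / (of_real n * w)) at_top"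
proof -
  define W where "W = of_real n * w"
  define s where "s = of_real n + v + 1"
  define f where "f t = exp (- (W * of_real t)) * of_real t powr (s - 1)" for t :: real
  have W: "Re W > 0" "W \<noteq> 0" and w0: "w \<noteq> 0" and s: "Re s > 1"
    unfolding W_def s_def using n w nv by auto
  have s1: "s - 1 = of_real n + v" by (simp add: s_def)
  have cont: "continuous_on {0..N} f" for N
    unfolding f_def using s by (intro continuous_on_mult continuous_intros continuous_on_of_real_powr) auto
  \<comment> \<open>Positivity of n makes the principal logarithm split, in agreement with the
    convention for (n w)^(-(n+v)).\<close>
  have LnW: "Ln W = of_real (ln n) + Ln w"
    unfolding W_def using n w0 by (simp add: Ln_times_of_real Ln_of_real)
  have "((\<lambda>N. integral {0..N} f) \<longlongrightarrow> exp (- s * Ln W) * Gamma s) at_top"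
    unfolding f_def using s W by (intro scaled_Gamma_integral_tendsto)
  moreover have "filterlim (\<lambda>N::real. N + 1) at_top at_top" by real_asymp
  ultimately have "((\<lambda>N. integral {0..N + 1} f) \<longlongrightarrow> exp (- s * Ln W) * Gamma s) at_top"
    by (rule filterlim_compose)
  hence lim: "((\<lambda>N. exp W * (integral {0..N + 1} f - integral {0..1} f))
       \<longlongrightarrow> exp W * (exp (- s * Ln W) * Gamma s - integral {0..1} f)) at_top"
    by (intro tendsto_intros)
  have "exp W * integral {0..1} f = (S_fun n w v - 1) / W"
  proof -
    have "exp W * integral {0..1} f = integral {0..1} (\<lambda>t. exp W * f t)"
      by simp
    also have "(\<lambda>t. exp W * f t) = (\<lambda>z. exp (of_real n * w * of_real (1 - z)) * of_real z powr (of_real n + v))"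
    proof
      fix z :: real
      have "exp (of_real n * w * of_real (1 - z)) = exp W * exp (- (W * of_real z))"
        unfolding exp_add [symmetric] W_def by (simp add: algebra_simps)
      thus "exp W * f z = exp (of_real n * w * of_real (1 - z)) * of_real z powr (of_real n + v)"
        unfolding f_def s1 by simp
    qed
    finally show ?thesis using W(2) unfolding S_fun_def W_def by simp
  qed
  moreover have "exp W * (exp (- s * Ln W) * Gamma s)
      = exp W * exp (- (of_real n + v) * of_real (ln n)) * exp (- (of_real n + v) * Ln w) * Gamma s / W"
  proof -
    have "- s * Ln W = - (of_real n + v) * of_real (ln n) + - (of_real n + v) * Ln w - Ln W"
      unfolding s_def LnW by (simp add: algebra_simps)
    hence "exp (- s * Ln W) = exp (- (of_real n + v) * of_real (ln n)) * exp (- (of_real n + v) * Ln w) / W"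
      by (simp only: exp_diff exp_add exp_Ln[OF W(2)])
    thus ?thesis by simp
  qed
  ultimately have "exp W * (exp (- s * Ln W) * Gamma s - integral {0..1} f) = (T_fun n w v + 1) / W"
    unfolding T_fun_def s_def W_def right_diff_distrib by (simp add: diff_divide_distrib add_divide_distrib)
  with lim have lim': "((\<lambda>N. exp W * (integral {0..N + 1} f - integral {0..1} f)) \<longlongrightarrow> (T_fun n w v + 1) / W) at_top"
    by (simp only:)
  have "exp W * (integral {0..N + 1} f - integral {0..1} f) = ray_integral (- 1) w v n N" if N: "N \<ge> 0" for N
  proof -
    have "integral {0..1} f + integral {1..N + 1} f = integral {0..N + 1} f"
      using N cont by (intro Henstock_Kurzweil_Integration.integral_combine integrable_continuous_interval) auto
    hence "exp W * (integral {0..N + 1} f - integral {0..1} f) = exp W * integral {1..N + 1} f"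
      by (metis add_diff_cancel_left')
    also have "integral {1..N + 1} f = integral {0..N} (f \<circ> (+) 1)"
      by (subst integral_shift_Icc_real) simp
    also have "exp W * integral {0..N} (f \<circ> (+) 1) = integral {0..N} (\<lambda>t. exp W * (f \<circ> (+) 1) t)"
      by (simp add: o_def)
    also have "(\<lambda>t. exp W * (f \<circ> (+) 1) t)
        = (\<lambda>t. exp (of_real n * w * (- 1 * of_real t)) * (1 - (- 1) * of_real t) powr (of_real n + v))"
    proof
      fix t :: real
      have "exp (of_real n * w * (- 1 * of_real t)) = exp W * exp (- (W * of_real (1 + t)))"
        unfolding exp_add [symmetric] W_def by (simp add: algebra_simps)
      thus "exp W * (f \<circ> (+) 1) t = exp (of_real n * w * (- 1 * of_real t)) * (1 - (- 1) * of_real t) powr (of_real n + v)"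
        unfolding f_def s1 by simp
    qed
    finally show ?thesis unfolding ray_integral_def .
  qed
  hence "eventually (\<lambda>N. exp W * (integral {0..N + 1} f - integral {0..1} f) = ray_integral (- 1) w v n N) at_top"
    by (rule eventually_mono[OF eventually_ge_at_top[of 0]])
  from Lim_transform_eventually[OF lim' this] show ?thesis unfolding W_def .
qed

text \<open>ln lies below its tangent at 1 - \<delta>, so t + ln (1 - t) is at most its value at
  \<delta>. This is used with factor n - a; the remaining exp (a t) is at most exp a.\<close>

lemma left_tail_bound:
  fixes t \<delta> n a :: real
  assumes "0 < \<delta>" "\<delta> < 1" "\<delta> \<le> t" "t \<le> 1" "0 \<le> a" "a \<le> n"
  shows "exp (n * t) * (1 - t) powr (n - a) \<le> exp a * exp ((n - a) * (\<delta> + ln (1 - \<delta>)))"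
proof (cases "t = 1")
  case False
  hence t: "t < 1" using assms by simp
  have "ln (1 - t) - ln (1 - \<delta>) = ln ((1 - t) / (1 - \<delta>))"
    using t assms by (simp add: ln_div)
  also have "\<dots> \<le> (1 - t) / (1 - \<delta>) - 1"
    using t assms by (intro ln_le_minus_one) simp
  also have "\<dots> = (\<delta> - t) / (1 - \<delta>)"
    using assms by (simp add: field_simps)
  also have "\<dots> \<le> (\<delta> - t) / 1"
    using assms by (intro divide_left_mono_neg) auto
  finally have "t + ln (1 - t) \<le> \<delta> + ln (1 - \<delta>)" by simp
  hence "(n - a) * (t + ln (1 - t)) \<le> (n - a) * (\<delta> + ln (1 - \<delta>))"
    using assms by (intro mult_left_mono) auto
  moreover have "a * t \<le> a * 1" using assms by (intro mult_mono) auto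
  ultimately show ?thesis
    using t by (simp add: powr_def exp_add [symmetric] algebra_simps)
qed auto

lemma continuous_on_ray_integrand:
  assumes "\<And>t. t \<in> A \<Longrightarrow> Re (1 - u * of_real t) \<ge> 0" "Re (of_real n + v) > 0"
  shows "continuous_on A (\<lambda>t::real. exp (of_real n * w * (u * of_real t)) * (1 - u * of_real t) powr (of_real n + v))"
proof (intro continuous_on_mult continuous_on_powr_complex)
  show "A \<subseteq> {t. Re (1 - u * of_real t) \<ge> 0 \<or> Im (1 - u * of_real t) \<noteq> 0}"
    using assms(1) by auto
qed (use assms(2) in \<open>auto intro!: continuous_intros\<close>)

text \<open>For Re w \<le> 1 the modulus of exp (n w t) is at most its value at w = 1, so one real
  estimate covers all these w. The rate is positive because ln x < x - 1 for x \<noteq> 1.\<close>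

lemma left_tail:
  assumes w: "Re w \<le> 1" and \<delta>: "0 < \<delta>" "\<delta> < 1"
  shows "(\<lambda>n. ray_integral 1 w v n 1 - ray_integral 1 w v n \<delta>) \<in> powr_O e"
proof -
  define a where "a = \<bar>Re v\<bar>"
  define c where "c = - (\<delta> + ln (1 - \<delta>))"
  have "ln (1 - \<delta>) \<noteq> (1 - \<delta>) - 1" using ln_eq_minus_one[of "1 - \<delta>"] \<delta> by auto
  moreover have "ln (1 - \<delta>) \<le> (1 - \<delta>) - 1" using \<delta> by (intro ln_le_minus_one) simp
  ultimately have c: "c > 0" unfolding c_def by simp
  show ?thesis
  proof (rule powr_O_exp[OF _ c])
    show "eventually (\<lambda>n. cmod (ray_integral 1 w v n 1 - ray_integral 1 w v n \<delta>) \<le> exp (a + a * c) * exp (- (c * n))) at_top"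
      using eventually_ge_at_top[of "a + 1"]
    proof eventually_elim
      case (elim n)
      define f where "f t = exp (of_real n * w * (1 * of_real t)) * (1 - 1 * of_real t) powr (of_real n + v)" for t :: real
      have n: "n \<ge> 0" "Re (of_real n + v) > 0" "n + Re v \<ge> n - a" "a \<le> n" "a \<ge> 0"
        using elim unfolding a_def by auto
      have cont: "continuous_on {0..1} f"
        unfolding f_def using n by (intro continuous_on_ray_integrand) auto
      have "integral {0..\<delta>} f + integral {\<delta>..1} f = integral {0..1} f"
        using \<delta> cont by (intro Henstock_Kurzweil_Integration.integral_combine integrable_continuous_interval) auto
      hence eq: "ray_integral 1 w v n 1 - ray_integral 1 w v n \<delta> = integral {\<delta>..1} f"
        unfolding ray_integral_def f_def [symmetric] by (simp add: algebra_simps)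
      have "cmod (integral {\<delta>..1} f) \<le> (exp a * exp ((n - a) * (\<delta> + ln (1 - \<delta>)))) * (1 - \<delta>)"
      proof (rule integral_bound)
        show "continuous_on {\<delta>..1} f" using cont by (rule continuous_on_subset) (use \<delta> in auto)
        show "cmod (f t) \<le> exp a * exp ((n - a) * (\<delta> + ln (1 - \<delta>)))" if t: "t \<in> {\<delta>..1}" for t
        proof -
          have "1 - 1 * complex_of_real t = of_real (1 - t)" by simp
          hence "cmod (f t) = exp (n * Re w * t) * (1 - t) powr (n + Re v)"
            using t unfolding f_def norm_mult by (simp only:) (subst norm_powr_real_powr, auto)
          also have "\<dots> \<le> exp (n * t) * (1 - t) powr (n - a)"
          proof (intro mult_mono powr_mono')
            have "n * Re w * t \<le> n * 1 * t" using w t n \<delta> by (intro mult_right_mono mult_left_mono) auto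
            thus "exp (n * Re w * t) \<le> exp (n * t)" by simp
          qed (use n t \<delta> in auto)
          also have "\<dots> \<le> exp a * exp ((n - a) * (\<delta> + ln (1 - \<delta>)))"
            using t \<delta> n by (intro left_tail_bound) auto
          finally show ?thesis .
        qed
      qed (use \<delta> in auto)
      also have "\<dots> \<le> (exp a * exp ((n - a) * (\<delta> + ln (1 - \<delta>)))) * 1"
        using \<delta> by (intro mult_left_mono) auto
      also have "\<dots> = exp (a + a * c) * exp (- (c * n))"
        unfolding c_def by (simp add: exp_add [symmetric] algebra_simps)
      finally show ?case unfolding eq .
    qed
  qed
qed

text \<open>By concavity, ln (1 + t) \<le> \<kappa> t beyond \<delta> once \<kappa> dominates the
  chord slope ln (1 + \<delta>) / \<delta> and the tangent slope 1 / (1 + \<delta>). The assumption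
  on n ensures that the factor (1 + t)^a costs at most half of the gain n (1 - \<kappa>) t.\<close>

lemma right_tail_bound:
  fixes t \<delta> n a \<kappa> :: real
  assumes "0 < \<delta>" "\<delta> \<le> t" "0 \<le> a" "0 \<le> n" "ln (1 + \<delta>) \<le> \<kappa> * \<delta>" "1 / (1 + \<delta>) \<le> \<kappa>"
    and n: "2 * a * \<kappa> \<le> n * (1 - \<kappa>)"
  shows "exp (- (n * t)) * (1 + t) powr (n + a) \<le> exp (- (n * ((1 - \<kappa>) / 2) * t))"
proof -
  have "ln (1 + t) - ln (1 + \<delta>) = ln ((1 + t) / (1 + \<delta>))"
    using assms by (simp add: ln_div)
  also have "\<dots> \<le> (1 + t) / (1 + \<delta>) - 1"
    using assms by (intro ln_le_minus_one) simp
  also have "\<dots> = 1 / (1 + \<delta>) * (t - \<delta>)"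
    using assms by (simp add: field_simps)
  also have "\<dots> \<le> \<kappa> * (t - \<delta>)"
    using assms by (intro mult_right_mono) auto
  finally have "ln (1 + t) \<le> \<kappa> * t" using assms(5) by (simp add: algebra_simps)
  hence "(n + a) * ln (1 + t) \<le> (n + a) * (\<kappa> * t)"
    using assms by (intro mult_left_mono) auto
  moreover have "2 * a * \<kappa> * t \<le> n * (1 - \<kappa>) * t" using n assms by (intro mult_right_mono) auto
  moreover have "- (n * t) + (n + a) * (\<kappa> * t) = - (n * (1 - \<kappa>) * t) + (2 * a * \<kappa> * t) / 2"
    by (simp add: algebra_simps)
  moreover have "n * ((1 - \<kappa>) / 2) * t = (n * (1 - \<kappa>) * t) / 2"
    by simp
  ultimately have "- (n * t) + (n + a) * ln (1 + t) \<le> - (n * ((1 - \<kappa>) / 2) * t)"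
    by linarith
  thus ?thesis using assms by (simp add: powr_def exp_add [symmetric])
qed

lemma integral_exp_decay_le:
  fixes \<eta> a b :: real
  assumes "\<eta> > 0" "a \<le> b"
  shows "(\<lambda>t. exp (- (\<eta> * t))) integrable_on {a..b}" "integral {a..b} (\<lambda>t. exp (- (\<eta> * t))) \<le> exp (- (\<eta> * a)) / \<eta>"
proof -
  have "((\<lambda>t. exp (- (\<eta> * t))) has_integral (- exp (- (\<eta> * b)) / \<eta> - - exp (- (\<eta> * a)) / \<eta>)) {a..b}"
    using assms by (intro fundamental_theorem_of_calculus)
      (auto intro!: derivative_eq_intros simp flip: has_real_derivative_iff_has_vector_derivative)
  from integral_unique[OF this] has_integral_integrable[OF this]
  show "(\<lambda>t. exp (- (\<eta> * t))) integrable_on {a..b}" "integral {a..b} (\<lambda>t. exp (- (\<eta> * t))) \<le> exp (- (\<eta> * a)) / \<eta>"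
    using assms by auto
qed

text \<open>(T_n + 1) / (n w) is known only as a limit of truncated integrals, so the piece from
  \<delta> to N is bounded uniformly in N before passing to the limit.\<close>

lemma right_tail:
  assumes w: "Re w \<ge> 1" and \<delta>: "0 < \<delta>"
  shows "(\<lambda>n. (T_fun n w v + 1) / (of_real n * w) - ray_integral (- 1) w v n \<delta>) \<in> powr_O e"
proof -
  define a where "a = \<bar>Re v\<bar>"
  \<comment> \<open>Chord and tangent slope of ln (1 + t) at \<delta>; taking the maximum saves
    comparing them, and both are below 1.\<close>
  define \<kappa> where "\<kappa> = max (ln (1 + \<delta>) / \<delta>) (1 / (1 + \<delta>))"
  have "ln (1 + \<delta>) \<noteq> (1 + \<delta>) - 1" using ln_eq_minus_one[of "1 + \<delta>"] \<delta> by auto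
  moreover have "ln (1 + \<delta>) \<le> (1 + \<delta>) - 1" using \<delta> by (intro ln_le_minus_one) simp
  ultimately have \<kappa>: "\<kappa> < 1" unfolding \<kappa>_def using \<delta> by simp
  have \<kappa>1: "ln (1 + \<delta>) \<le> \<kappa> * \<delta>" and \<kappa>2: "1 / (1 + \<delta>) \<le> \<kappa>"
    using \<delta> unfolding \<kappa>_def by (simp_all add: pos_divide_le_eq [symmetric])
  define \<eta> where "\<eta> = (1 - \<kappa>) / 2"
  have \<eta>: "\<eta> > 0" unfolding \<eta>_def using \<kappa> by simp
  show ?thesis
  proof (rule powr_O_exp[of _ "1 / \<eta>" "\<eta> * \<delta>"])
    show "eventually (\<lambda>n. cmod ((T_fun n w v + 1) / (of_real n * w) - ray_integral (- 1) w v n \<delta>)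
             \<le> 1 / \<eta> * exp (- (\<eta> * \<delta> * n))) at_top"
      using eventually_ge_at_top[of "a + 1"] eventually_ge_at_top[of 1] eventually_ge_at_top[of "2 * a * \<kappa> / (1 - \<kappa>)"]
    proof eventually_elim
      case (elim n)
      define f where "f t = exp (of_real n * w * (- 1 * of_real t)) * (1 - (- 1) * of_real t) powr (of_real n + v)" for t :: real
      have n: "n > 0" "Re (of_real n + v) > 0" "n + Re v \<le> n + a" "a \<ge> 0" "2 * a * \<kappa> \<le> n * (1 - \<kappa>)"
        using elim \<kappa> unfolding a_def by (auto simp: field_simps)
      have cont: "continuous_on {0..N} f" for N
        unfolding f_def using n by (intro continuous_on_ray_integrand) auto
      have bound: "cmod (ray_integral (- 1) w v n N - ray_integral (- 1) w v n \<delta>) \<le> exp (- (n * \<eta> * \<delta>)) / (n * \<eta>)"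
        if N: "N \<ge> \<delta>" for N
      proof -
        have "integral {0..\<delta>} f + integral {\<delta>..N} f = integral {0..N} f"
          using \<delta> N cont by (intro Henstock_Kurzweil_Integration.integral_combine integrable_continuous_interval) auto
        hence eq: "ray_integral (- 1) w v n N - ray_integral (- 1) w v n \<delta> = integral {\<delta>..N} f"
          unfolding ray_integral_def f_def [symmetric] by (simp add: algebra_simps)
        have "cmod (integral {\<delta>..N} f) \<le> integral {\<delta>..N} (\<lambda>t. exp (- (n * \<eta> * t)))"
        proof (rule integral_norm_bound_integral)
          show "f integrable_on {\<delta>..N}"
            using \<delta> by (intro integrable_continuous_interval continuous_on_subset[OF cont[of N]]) auto
          show "(\<lambda>t. exp (- (n * \<eta> * t))) integrable_on {\<delta>..N}"
            using n \<eta> N by (intro integral_exp_decay_le) auto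
          show "cmod (f t) \<le> exp (- (n * \<eta> * t))" if t: "t \<in> {\<delta>..N}" for t
          proof -
            have "1 - (- 1) * complex_of_real t = of_real (1 + t)" by simp
            hence "cmod (f t) = exp (- (n * Re w * t)) * (1 + t) powr (n + Re v)"
              using t \<delta> unfolding f_def norm_mult by (simp only:) (subst norm_powr_real_powr, auto)
            also have "\<dots> \<le> exp (- (n * t)) * (1 + t) powr (n + a)"
            proof (intro mult_mono powr_mono)
              have "n * 1 * t \<le> n * Re w * t" using w t n \<delta> by (intro mult_right_mono mult_left_mono) auto
              thus "exp (- (n * Re w * t)) \<le> exp (- (n * t))" by simp
            qed (use n t \<delta> in auto)
            also have "\<dots> \<le> exp (- (n * \<eta> * t))"
              unfolding \<eta>_def using t \<delta> n \<kappa>1 \<kappa>2 by (intro right_tail_bound) auto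
            finally show ?thesis .
          qed
        qed
        also have "\<dots> \<le> exp (- (n * \<eta> * \<delta>)) / (n * \<eta>)"
          using n \<eta> N by (intro integral_exp_decay_le) auto
        finally show ?thesis unfolding eq .
      qed
      have "((\<lambda>N. ray_integral (- 1) w v n N - ray_integral (- 1) w v n \<delta>) \<longlongrightarrow>
               (T_fun n w v + 1) / (of_real n * w) - ray_integral (- 1) w v n \<delta>) at_top"
        using n w by (intro tendsto_diff tendsto_const T_fun_ray_integral_tendsto) auto
      moreover have "eventually (\<lambda>N. cmod (ray_integral (- 1) w v n N - ray_integral (- 1) w v n \<delta>)
          \<le> exp (- (n * \<eta> * \<delta>)) / (n * \<eta>)) at_top"
        by (rule eventually_mono[OF eventually_ge_at_top[of \<delta>] bound])
      ultimately have "cmod ((T_fun n w v + 1) / (of_real n * w) - ray_integral (- 1) w v n \<delta>)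
          \<le> exp (- (n * \<eta> * \<delta>)) / (n * \<eta>)"
        by (rule Lim_norm_ubound[rotated]) simp
      also have "\<dots> \<le> exp (- (n * \<eta> * \<delta>)) / (1 * \<eta>)"
        using elim \<eta> n by (intro divide_left_mono mult_right_mono) auto
      finally show ?case by (simp add: mult_ac)
    qed
  qed (use \<eta> \<delta> in auto)
qed

section \<open>The line of real part 1\<close>

text \<open>The factor -u is dz/dt for z = 1 - u t. This puts ray integrals into the form that
  Cauchy's theorem requires.\<close>

lemma has_contour_integral_ray:
  assumes "\<epsilon> > 0" "\<And>t. t \<in> {0..\<epsilon>} \<Longrightarrow> Re (1 - u * of_real t) \<ge> 0" "Re (of_real n + v) > 0"
  shows "((\<lambda>z. exp (of_real n * w * (1 - z)) * z powr (of_real n + v)) has_contour_integral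
            - u * ray_integral u w v n \<epsilon>) (linepath 1 (1 - of_real \<epsilon> * u))"
proof -
  define g where "g t = exp (of_real n * w * (u * of_real t)) * (1 - u * of_real t) powr (of_real n + v)" for t :: real
  have "(g has_integral ray_integral u w v n \<epsilon>) {0..\<epsilon>}"
    unfolding ray_integral_def g_def
    by (intro integrable_integral integrable_continuous_interval continuous_on_ray_integrand assms)
  from has_integral_stretch_real[OF this, of \<epsilon>]
  have "((\<lambda>x. g (\<epsilon> * x)) has_integral (1 / \<bar>\<epsilon>\<bar>) *\<^sub>R ray_integral u w v n \<epsilon>) ((\<lambda>x. x / \<epsilon>) ` {0..\<epsilon>})"
    using assms(1) by simp
  moreover have "(\<lambda>x. x / \<epsilon>) ` {0..\<epsilon>} = {0..1}"
  proof -
    have "(\<lambda>x. x / \<epsilon>) ` {0..\<epsilon>} = {0 / \<epsilon>..\<epsilon> / \<epsilon>}"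
      using assms(1) by (simp add: image_divide_atLeastAtMost)
    thus ?thesis using assms(1) by simp
  qed
  ultimately have "((\<lambda>x. g (\<epsilon> * x)) has_integral (1 / \<bar>\<epsilon>\<bar>) *\<^sub>R ray_integral u w v n \<epsilon>) {0..1}"
    by (simp only:)
  from has_integral_mult_left[OF this, of "- (of_real \<epsilon> * u)"]
  have "((\<lambda>x. g (\<epsilon> * x) * - (of_real \<epsilon> * u)) has_integral (1 / \<bar>\<epsilon>\<bar>) *\<^sub>R ray_integral u w v n \<epsilon> * - (of_real \<epsilon> * u)) {0..1}" .
  moreover have "(1 / \<bar>\<epsilon>\<bar>) *\<^sub>R ray_integral u w v n \<epsilon> * - (of_real \<epsilon> * u) = - u * ray_integral u w v n \<epsilon>"
    using assms(1) by (simp add: scaleR_conv_of_real)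
  moreover have "linepath 1 (1 - of_real \<epsilon> * u) x = 1 - u * of_real (\<epsilon> * x)" for x
    unfolding linepath_def by (simp add: scaleR_conv_of_real algebra_simps)
  ultimately show ?thesis
    unfolding has_contour_integral_linepath g_def by simp
qed

text \<open>The inequality ln x \<le> x - 1 cancels n - a of the n factors exp (1 - x); the other a
  contribute at most exp a.\<close>

lemma powr_exp_bound:
  fixes x n a :: real
  assumes "0 \<le> x" "x \<le> 1" "0 \<le> a" "a \<le> n"
  shows "exp (n * (1 - x)) * x powr (n - a) \<le> exp a"
proof (cases "x = 0")
  case False
  hence x: "x > 0" using assms by simp
  have "(n - a) * ln x \<le> (n - a) * (x - 1)"
    using assms x by (intro mult_left_mono ln_le_minus_one) auto
  moreover have "a * (1 - x) \<le> a * 1" using assms by (intro mult_left_mono) auto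
  ultimately have "n * (1 - x) + (n - a) * ln x \<le> a" by (simp add: algebra_simps)
  thus ?thesis using x by (simp add: powr_def exp_add [symmetric])
qed auto

text \<open>On the line \<open>Re w = 1\<close> the integrand of \<open>S_n\<close> only decays like a Gaussian away from 1.
  Leaving 1 in the direction \<open>-u\<close> with \<open>Re ((1 - w) u) > 0\<close> restores exponential decay; \<open>u\<close> is chosen
  such that \<open>Re (w z1) = 1\<close> at the corner \<open>z1 = 1 - \<epsilon> u\<close>, which makes \<open>|z1|^n\<close> a bound on the
  segment from 0 to \<open>z1\<close>.\<close>

lemma bent_contour:
  fixes w v :: complex
  assumes w: "Re w = 1" "Im w \<noteq> 0"
  defines "u \<equiv> Complex 1 (1 / Im w)"
  assumes \<epsilon>: "0 < \<epsilon>" "\<epsilon> < 1" and corner: "cmod (1 - of_real \<epsilon> * u) < 1"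
  shows "(\<lambda>n. ray_integral 1 w v n 1 - u * ray_integral u w v n \<epsilon>) \<in> powr_O e"
proof -
  define z1 where "z1 = 1 - of_real \<epsilon> * u"
  define a where "a = \<bar>Re v\<bar>"
  define c where "c = - ln (cmod z1)"
  have Re_z1: "Re z1 = 1 - \<epsilon>" unfolding z1_def u_def by simp
  have z1: "z1 \<noteq> 0" using Re_z1 \<epsilon> by auto
  \<comment> \<open>For this u the product w u is purely imaginary, so Re (w z) keeps its value 1
    along the whole ray.\<close>
  have Re_wz1: "Re (w * z1) = 1" unfolding z1_def u_def using w by (simp add: field_simps)
  have c: "c > 0" unfolding c_def using z1 corner z1_def by simp
  show ?thesis
  proof (rule powr_O_exp[OF _ c])
    show "eventually (\<lambda>n. cmod (ray_integral 1 w v n 1 - u * ray_integral u w v n \<epsilon>)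
        \<le> (exp a * exp (a * c) * exp (pi * \<bar>Im v\<bar>) * cmod z1) * exp (- (c * n))) at_top"
      using eventually_ge_at_top[of "a + 1"]
    proof eventually_elim
      case (elim n)
      have n: "n \<ge> 0" "Re (of_real n + v) > 0" "n + Re v \<ge> n - a" "a \<le> n" "a \<ge> 0"
        using elim unfolding a_def by auto
      define f where "f z = exp (of_real n * w * (1 - z)) * z powr (of_real n + v)" for z
      \<comment> \<open>The triangle between the straight path 1, 0 and the bent path 1,
        \<open>z1\<close>, 0. Its corner 0 lies on the branch cut, so holomorphy is claimed only in
        the interior and continuity on the whole triangle.\<close>
      define H where "H = convex hull {1, 0, z1}"
      have H: "H \<subseteq> {z. Re z \<ge> 0}"
        unfolding H_def using Re_z1 \<epsilon> by (intro hull_minimal) (auto simp: convex_halfspace_Re_ge)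
      have cont: "continuous_on H f"
        unfolding f_def using H n(2)
        by (intro continuous_on_mult continuous_on_powr_complex continuous_intros) auto
      have "interior {z. Re z \<ge> 0} = {z. Re z > 0}"
        using interior_halfspace_ge[of "1::complex" 0] by (simp add: inner_complex_def)
      hence int: "interior H \<subseteq> {z. Re z > 0}"
        using interior_mono[OF H] by simp
      have "f holomorphic_on interior H"
        unfolding f_def using int by (intro holomorphic_intros) (auto simp: complex_nonpos_Reals_iff)
      hence "(f has_contour_integral 0) (linepath 1 0 +++ linepath 0 z1 +++ linepath z1 1)"
        using cont unfolding H_def by (intro Cauchy_theorem_triangle_interior)
      hence sum0: "contour_integral (linepath 1 0) f + contour_integral (linepath 0 z1) f + contour_integral (linepath z1 1) f = 0"
        by (rule has_chain_integral_chain_integral3)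
      have "(f has_contour_integral - 1 * ray_integral 1 w v n 1) (linepath 1 (1 - of_real 1 * 1))"
        unfolding f_def using n by (intro has_contour_integral_ray) auto
      hence i1: "contour_integral (linepath 1 0) f = - ray_integral 1 w v n 1"
        by (intro contour_integral_unique) simp
      have "(f has_contour_integral - u * ray_integral u w v n \<epsilon>) (linepath 1 (1 - of_real \<epsilon> * u))"
        unfolding f_def using n \<epsilon> by (intro has_contour_integral_ray) (auto simp: u_def)
      from has_contour_integral_reverse_linepath[OF this]
      have i2: "contour_integral (linepath z1 1) f = u * ray_integral u w v n \<epsilon>"
        unfolding z1_def by (intro contour_integral_unique) simp
      have eq: "ray_integral 1 w v n 1 - u * ray_integral u w v n \<epsilon> = contour_integral (linepath 0 z1) f"
        using sum0 unfolding i1 i2 by (simp add: algebra_simps add_eq_0_iff)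
      have seg: "closed_segment 0 z1 \<subseteq> H"
        unfolding H_def by (simp add: segments_subset_convex_hull)
      have "cmod (contour_integral (linepath 0 z1) f)
          \<le> (exp a * cmod z1 powr (n - a) * exp (pi * \<bar>Im v\<bar>)) * cmod (z1 - 0)"
      proof (rule contour_integral_bound_linepath)
        show "f contour_integrable_on linepath 0 z1"
          using continuous_on_subset[OF cont seg] by (rule contour_integrable_continuous_linepath)
        show "cmod (f z) \<le> exp a * cmod z1 powr (n - a) * exp (pi * \<bar>Im v\<bar>)" if z: "z \<in> closed_segment 0 z1" for z
        proof -
          obtain x where x: "0 \<le> x" "x \<le> 1" "z = of_real x * z1"
            using z by (auto simp: in_segment scaleR_conv_of_real)
          \<comment> \<open>On z = x \<open>z1\<close> the exponential has modulus exp (n (1 - x)),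
            which the power of x offsets by \<open>powr_exp_bound\<close>; the power of |z1| remains
            and decays.\<close>
          have "Re (w * (of_real x * z1)) = x * Re (w * z1)"
            by (simp add: algebra_simps)
          hence Re_w: "Re (of_real n * w * (1 - z)) = n * (1 - x)"
            unfolding x(3) using w(1) Re_wz1 by (simp add: algebra_simps)
          have "cmod (f z) = exp (n * (1 - x)) * ((x * cmod z1) powr (n + Re v) * exp (- Im v * Arg z))"
            unfolding f_def norm_mult norm_exp_eq_Re Re_w norm_powr_complex using x by (simp add: x(3) norm_mult)
          also have "\<dots> \<le> exp (n * (1 - x)) * ((x powr (n - a) * cmod z1 powr (n - a)) * exp (pi * \<bar>Im v\<bar>))"
          proof (intro mult_left_mono mult_mono)
            have "(x * cmod z1) powr (n + Re v) \<le> (x * cmod z1) powr (n - a)"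
              using x n corner unfolding z1_def [symmetric] by (intro powr_mono') (auto intro: mult_le_one)
            thus "(x * cmod z1) powr (n + Re v) \<le> x powr (n - a) * cmod z1 powr (n - a)"
              using x by (simp add: powr_mult)
            \<comment> \<open>For complex v the modulus of z^v also involves Arg z; the bound pi on
              |Arg z| turns this into a constant.\<close>
            have "\<bar>- Im v * Arg z\<bar> \<le> \<bar>Im v\<bar> * pi"
              using Arg_le_pi[of z] mpi_less_Arg[of z] unfolding abs_mult abs_minus_cancel by (intro mult_left_mono) auto
            thus "exp (- Im v * Arg z) \<le> exp (pi * \<bar>Im v\<bar>)" by (simp add: mult.commute)
          qed auto
          also have "\<dots> = (exp (n * (1 - x)) * x powr (n - a)) * (cmod z1 powr (n - a) * exp (pi * \<bar>Im v\<bar>))"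
            by simp
          also have "\<dots> \<le> exp a * (cmod z1 powr (n - a) * exp (pi * \<bar>Im v\<bar>))"
            using powr_exp_bound[of x a n] x n by (intro mult_right_mono) auto
          finally show ?thesis by simp
        qed
      qed auto
      also have "cmod z1 powr (n - a) = exp (a * c) * exp (- (c * n))"
        unfolding c_def using z1 by (simp add: powr_def exp_add [symmetric] algebra_simps)
      finally show ?case unfolding eq by (simp only: diff_zero mult_ac)
    qed
  qed
qed

section \<open>Expansions away from 1\<close>

text \<open>The De Moivre polynomials of 1/(p+1), 1/(p+2), ... are coefficients of powers of the
  remainder series, and the sum over m is the Cauchy product with the binomial series. Its sign
  (-1)^(r-m) differs from (-1)^m by (-1)^r. The weights \<open>h\<close> stay general because U,
  \<gamma> and \<rho> use different ones.\<close>

lemma deMoivre_sum_eq_phase_coeff: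
  assumes seq: "\<And>j. s j = 1 / of_nat (j + p)" and r: "r < M"
  shows "(\<Sum>m=0..r. (-1) ^ m * (v gchoose (r - m)) * (\<Sum>k=0..m. h k * deMoivre m k s))
       = (\<Sum>k<M. h k * ((-1) ^ r * phase_coeff p v k r))"
proof -
  define F where "F = log_remainder_fps p"
  have dm: "deMoivre m k s = fps_nth (F ^ k) m" for m k
    unfolding deMoivre_def F_def log_remainder_fps_def seq ..
  have zero: "fps_nth (F ^ k) m = 0" if "m < k" for m k
    using that startsby_zero_power_prefix[of F k] by (auto simp: F_def log_remainder_fps_def)
  have inner: "(\<Sum>k=0..m. h k * deMoivre m k s) = (\<Sum>k<M. h k * fps_nth (F ^ k) m)" if "m \<le> r" for m
    unfolding dm by (rule sum.mono_neutral_left) (use that r zero in auto)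
  have "(\<Sum>m=0..r. (-1) ^ m * (v gchoose (r - m)) * (\<Sum>k=0..m. h k * deMoivre m k s))
      = (\<Sum>m=0..r. \<Sum>k<M. (-1) ^ m * (v gchoose (r - m)) * (h k * fps_nth (F ^ k) m))"
    by (rule sum.cong) (auto simp: inner sum_distrib_left)
  also have "\<dots> = (\<Sum>k<M. \<Sum>m=0..r. (-1) ^ m * (v gchoose (r - m)) * (h k * fps_nth (F ^ k) m))"
    by (rule sum.swap)
  also have "\<dots> = (\<Sum>k<M. h k * ((-1) ^ r * phase_coeff p v k r))"
  proof (rule sum.cong)
    fix k
    have "(-1) ^ m * (v gchoose (r - m)) * (h k * fps_nth (F ^ k) m)
        = h k * ((-1) ^ r * (fps_nth (F ^ k) m * ((-1) ^ (r - m) * (v gchoose (r - m)))))" if "m \<in> {0..r}" for m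
    proof -
      have "(-1 :: complex) ^ m = (-1) ^ r * (-1) ^ (r - m)"
        using that by (simp add: power_add [symmetric] uminus_power_if)
      thus ?thesis by simp
    qed
    thus "(\<Sum>m=0..r. (-1) ^ m * (v gchoose (r - m)) * (h k * fps_nth (F ^ k) m)) = h k * ((-1) ^ r * phase_coeff p v k r)"
      unfolding phase_coeff_def fps_mult_nth F_def [symmetric] one_minus_powr_fps_def fps_nth_Abs_fps sum_distrib_left
      by (intro sum.cong) auto
  qed simp
  finally show ?thesis .
qed

text \<open>Every power of u cancels: the direction of the ray does not affect the coefficients,
  which is what permits the bent path. The sign comes from replacing (1 - w)^(k+r+1) by (w -
  1)^(k+r+1).\<close>

lemma U_coef_eq_phase_coeff:
  assumes "w \<noteq> 1" "u \<noteq> 0" "r < M"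
  shows "w * u * (\<Sum>k<M. (- (u ^ 1)) ^ k * u ^ r * phase_coeff 1 v k r / fact k
            * (fact (1 * k + r) / ((1 - w) * u) ^ (1 * k + r + 1)))
       = U_coef r w v - (if r = 0 then 1 else 0)"
proof -
  have "w * u * ((- (u ^ 1)) ^ k * u ^ r * d / fact k * (fact (1 * k + r) / ((1 - w) * u) ^ (1 * k + r + 1)))
      = - ((w / (w - 1) ^ (r + k + 1) * (fact (r + k) / fact k)) * ((-1) ^ r * d))" for k d
  proof -
    have "((1 - w) * u) ^ (k + r + 1) = (- 1 * ((w - 1) * u)) ^ (k + r + 1)"
      by (simp add: algebra_simps)
    also have "\<dots> = (- 1) ^ (k + r + 1) * ((w - 1) ^ (k + r + 1) * u ^ (k + r + 1))"
      by (simp only: power_mult_distrib)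
    finally have b: "((1 - w) * u) ^ (k + r + 1) = (- 1) ^ k * (- 1) ^ r * - 1 * ((w - 1) ^ (r + k + 1) * (u ^ k * u ^ r * u))"
      by (simp add: power_add mult_ac)
    have u: "(- (u ^ 1)) ^ k = (- 1) ^ k * u ^ k"
      by (simp add: power_minus[of u])
    have "w * u * (e * uk * ur * d / f * (g / (e * e' * - 1 * (x * (uk * ur * u))))) = - ((w / x * (g / f)) * (e' * d))"
      if "e \<noteq> 0" "e' * e' = 1" "uk \<noteq> 0" "ur \<noteq> 0" "x \<noteq> 0" "f \<noteq> 0" for e e' uk ur f g x :: complex
    proof -
      have "e' \<noteq> 0" using that(2) by auto
      hence "1 / e' = e'" using that(2) by (simp add: field_simps)
      moreover have "w * u * (e * uk * ur * d / f * (g / (e * e' * - 1 * (x * (uk * ur * u))))) = - ((w / x * (g / f)) * ((1 / e') * d))"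
        using that assms(2) \<open>e' \<noteq> 0\<close> by (simp add: field_simps)
      ultimately show ?thesis by simp
    qed
    note gen = this[of "(- 1) ^ k" "(- 1) ^ r" "u ^ k" "u ^ r" "(w - 1) ^ (r + k + 1)" "fact k" "fact (r + k)"]
    have "(- 1) ^ r * (- 1) ^ r = (1 :: complex)"
      by (simp add: power_mult_distrib [symmetric])
    thus ?thesis unfolding mult_1 b u using gen assms by (simp add: add.commute)
  qed
  hence "w * u * (\<Sum>k<M. (- (u ^ 1)) ^ k * u ^ r * phase_coeff 1 v k r / fact k
            * (fact (1 * k + r) / ((1 - w) * u) ^ (1 * k + r + 1)))
      = - (\<Sum>k<M. (w / (w - 1) ^ (r + k + 1) * (fact (r + k) / fact k)) * ((-1) ^ r * phase_coeff 1 v k r))"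
    unfolding sum_distrib_left sum_negf [symmetric] by (intro sum.cong) simp_all
  also have "\<dots> = U_coef r w v - (if r = 0 then 1 else 0)"
    unfolding U_coef_def
    by (subst deMoivre_sum_eq_phase_coeff[of seq2 1 r M, symmetric]) (use assms in \<open>auto simp: seq2_def\<close>)
  finally show ?thesis .
qed

text \<open>The case p = 1 of \<open>ray_expansion\<close>; the factor n turns n^(-(r+1)) into
  n^(-r). The Kronecker delta in U_0 stands for the summand 1 of S_n and is therefore subtracted
  here.\<close>

lemma U_ray_expansion:
  assumes R: "R \<ge> 1" and b: "Re ((1 - w) * u) > 0"
  obtains \<delta>\<^sub>0 where "\<delta>\<^sub>0 > 0" "\<And>\<delta>. 0 < \<delta> \<Longrightarrow> \<delta> \<le> \<delta>\<^sub>0 \<Longrightarrow>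
      (\<lambda>n. of_real n * w * (u * ray_integral u w v n \<delta>)
          - (\<Sum>r<R. (U_coef r w v - (if r = 0 then 1 else 0)) / of_real n ^ r)) \<in> powr_O (- real R)"
proof -
  have wu: "w \<noteq> 1" "u \<noteq> 0" using b by auto
  define \<mu> where "\<mu> l = fact l / ((1 - w) * u) ^ (l + 1)" for l :: nat
  define X where "X r = (\<Sum>k<R. (- (u ^ 1)) ^ k * u ^ r * phase_coeff 1 v k r / fact k * \<mu> (1 * k + r))" for r
  obtain \<delta>\<^sub>0 where \<delta>\<^sub>0: "\<delta>\<^sub>0 > 0" "\<And>\<delta>. 0 < \<delta> \<Longrightarrow> \<delta> \<le> \<delta>\<^sub>0 \<Longrightarrow>
      (\<lambda>n. integral {0..\<delta>} (\<lambda>t. exp (of_real n * w * (u * of_real t)) * (1 - u * of_real t) powr (of_real n + v))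
           - (\<Sum>r<R. of_real (n powr (- real (r + 1) / real 1)) *
                (\<Sum>k<R. (- (u ^ 1)) ^ k * u ^ r * phase_coeff 1 v k r / fact k * \<mu> (1 * k + r))))
         \<in> powr_O (- real (R + 1) / real 1)"
  proof (rule ray_expansion[of 1 R "(1 - w) * u" w u \<mu> v])
    show "w * u * of_real t - (\<Sum>j=1..1. (u * of_real t) ^ j / of_nat j) = - ((1 - w) * u) * of_real (t ^ 1)" for t
      by (simp add: algebra_simps)
    show "(\<lambda>n. integral {0..\<delta>} (\<lambda>t. exp (- (of_real (n * t ^ 1) * ((1 - w) * u))) * of_real (t ^ l))
                        - \<mu> l * of_real (n powr (- real (l + 1) / real 1))) \<in> powr_O e" if "\<delta> > 0" for \<delta> l e
      unfolding \<mu>_def using that b by (rule exponential_moments)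
    show "(\<lambda>n. of_real (integral {0..\<delta>} (\<lambda>t. exp (- (n * t ^ 1 * (Re ((1 - w) * u) / 2))) * t ^ l)))
             \<in> powr_O (- real (l + 1) / real 1)" if "\<delta> > 0" for \<delta> l
      by (rule moment_bound[where \<mu> = "\<lambda>l. fact l / of_real (Re ((1 - w) * u) / 2) ^ (l + 1)"],
          rule exponential_moments[OF that]) (use b in auto)
  qed (use R b that in auto)
  show ?thesis
  proof (rule that[OF \<delta>\<^sub>0(1)])
    fix \<delta> assume \<delta>: "0 < \<delta>" "\<delta> \<le> \<delta>\<^sub>0"
    have 1: "(\<lambda>n. of_real n ^ 1) \<in> powr_O (real 1)" by (rule powr_O_power)
    have "(\<lambda>n. (w * u) * (of_real n ^ 1 * (ray_integral u w v n \<delta> - (\<Sum>r<R. of_real (n powr (- real (r + 1) / real 1)) * X r))))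
        \<in> powr_O (- real R)"
      using \<delta>\<^sub>0(2)[OF \<delta>] unfolding ray_integral_def X_def
      by (intro powr_O_cmult powr_O_mult'[OF 1]) auto
    moreover have "eventually (\<lambda>n. (w * u) * (of_real n ^ 1 * (ray_integral u w v n \<delta> - (\<Sum>r<R. of_real (n powr (- real (r + 1) / real 1)) * X r)))
        = of_real n * w * (u * ray_integral u w v n \<delta>)
          - (\<Sum>r<R. (U_coef r w v - (if r = 0 then 1 else 0)) / of_real n ^ r)) at_top"
      using eventually_gt_at_top[of 0]
    proof eventually_elim
      case (elim n)
      have "complex_of_real n * of_real (n powr (- real (r + 1) / real 1)) = 1 / of_real n ^ r" for r
      proof -
        have "n powr (- real (r + 1) / real 1) = 1 / n ^ (r + 1)"
          by (simp only: of_nat_1 div_by_1 powr_minus_divide powr_realpow[OF elim])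
        thus ?thesis using elim by simp
      qed
      hence "(w * u) * (of_real n * (of_real (n powr (- real (r + 1) / real 1)) * X r))
         = (w * u * X r) / of_real n ^ r" for r
        by (simp add: mult.assoc [symmetric])
      hence "(w * u) * (of_real n * (\<Sum>r<R. of_real (n powr (- real (r + 1) / real 1)) * X r))
          = (\<Sum>r<R. (w * u * X r) / of_real n ^ r)"
        unfolding sum_distrib_left by (simp only:)
      also have "\<dots> = (\<Sum>r<R. (U_coef r w v - (if r = 0 then 1 else 0)) / of_real n ^ r)"
        using U_coef_eq_phase_coeff[OF wu, of _ R v] unfolding X_def \<mu>_def by (intro sum.cong) auto
      finally show ?case
        by (simp only: power_one_right right_diff_distrib) (simp add: mult_ac)
    qed
    ultimately show "(\<lambda>n. of_real n * w * (u * ray_integral u w v n \<delta>)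
          - (\<Sum>r<R. (U_coef r w v - (if r = 0 then 1 else 0)) / of_real n ^ r)) \<in> powr_O (- real R)"
      by (rule powr_O_cong)
  qed
qed

lemma sum_delta_over_power:
  assumes "R \<ge> 1"
  shows "(\<Sum>r<R. (c r - (if r = 0 then 1 else 0)) / x ^ r) = (\<Sum>r<R. c r / x ^ r) - (1 :: complex)"
proof -
  have "(\<Sum>r<R. (if r = 0 then 1 else 0) / x ^ r) = (\<Sum>r<R. if r = 0 then 1 else 0 :: complex)"
    by (intro sum.cong) auto
  thus ?thesis using assms by (simp add: diff_divide_distrib sum_subtractf)
qed

lemma S_fun_expansion:
  assumes R: "R \<ge> 1" and w: "Re w \<le> 1" "w \<noteq> 1"
  shows "(\<lambda>n. S_fun n w v - (\<Sum>r<R. U_coef r w v / of_real n ^ r)) \<in> powr_O (- real R)"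
proof -
  obtain u \<delta> where tail: "\<And>e. (\<lambda>n. ray_integral 1 w v n 1 - u * ray_integral u w v n \<delta>) \<in> powr_O e"
    and main: "(\<lambda>n. of_real n * w * (u * ray_integral u w v n \<delta>)
          - (\<Sum>r<R. (U_coef r w v - (if r = 0 then 1 else 0)) / of_real n ^ r)) \<in> powr_O (- real R)"
  proof (cases "Re w = 1")
    case False
    have "Re ((1 - w) * 1) > 0" using w False by simp
    from U_ray_expansion[OF R this, of v] obtain \<delta>\<^sub>0 where \<delta>\<^sub>0: "\<delta>\<^sub>0 > 0"
      "\<And>\<delta>. 0 < \<delta> \<Longrightarrow> \<delta> \<le> \<delta>\<^sub>0 \<Longrightarrow> (\<lambda>n. of_real n * w * (1 * ray_integral 1 w v n \<delta>)
          - (\<Sum>r<R. (U_coef r w v - (if r = 0 then 1 else 0)) / of_real n ^ r)) \<in> powr_O (- real R)"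
      by blast
    show ?thesis
    proof (rule that)
      \<comment> \<open>\<open>left_tail\<close> requires \<delta> < 1, hence the cap 1/2.\<close>
      show "(\<lambda>n. ray_integral 1 w v n 1 - 1 * ray_integral 1 w v n (min \<delta>\<^sub>0 (1/2))) \<in> powr_O e" for e
        using left_tail[OF w(1), of "min \<delta>\<^sub>0 (1/2)" v e] \<delta>\<^sub>0(1) by simp
    qed (use \<delta>\<^sub>0 in auto)
  next
    case True
    hence y: "Im w \<noteq> 0" using w(2) by (auto simp: complex_eq_iff)
    define u where "u = Complex 1 (1 / Im w)"
    have "Re ((1 - w) * u) > 0" unfolding u_def using True y by simp
    from U_ray_expansion[OF R this, of v] obtain \<delta>\<^sub>0 where \<delta>\<^sub>0: "\<delta>\<^sub>0 > 0"
      "\<And>\<delta>. 0 < \<delta> \<Longrightarrow> \<delta> \<le> \<delta>\<^sub>0 \<Longrightarrow> (\<lambda>n. of_real n * w * (u * ray_integral u w v n \<delta>)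
          - (\<Sum>r<R. (U_coef r w v - (if r = 0 then 1 else 0)) / of_real n ^ r)) \<in> powr_O (- real R)"
      by blast
    \<comment> \<open>q = |u|^2, and |1 - \<epsilon> u|^2 = 1 - 2 \<epsilon> + \<epsilon>^2 q is
      below 1 as soon as \<epsilon> q \<le> 1.\<close>
    define q where "q = 1 + (1 / Im w)\<^sup>2"
    define \<epsilon> where "\<epsilon> = min \<delta>\<^sub>0 (min (1 / 2) (1 / q))"
    have q: "q > 0" unfolding q_def by (simp add: add_pos_nonneg)
    have \<epsilon>: "0 < \<epsilon>" "\<epsilon> < 1" "\<epsilon> \<le> \<delta>\<^sub>0" unfolding \<epsilon>_def using \<delta>\<^sub>0(1) q by auto
    have "\<epsilon> \<le> 1 / q" unfolding \<epsilon>_def by simp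
    hence "\<epsilon> * q \<le> 1" using q by (simp add: pos_le_divide_eq)
    hence "\<epsilon> * (\<epsilon> * q) \<le> \<epsilon> * 1" using \<epsilon> by (intro mult_left_mono) auto
    moreover have "(cmod (1 - of_real \<epsilon> * u))\<^sup>2 = 1 - 2 * \<epsilon> + \<epsilon> * (\<epsilon> * q)"
      unfolding cmod_power2 u_def q_def by (simp add: power2_eq_square algebra_simps)
    ultimately have "(cmod (1 - of_real \<epsilon> * u))\<^sup>2 < 1\<^sup>2" using \<epsilon>(1) by simp
    hence corner: "cmod (1 - of_real \<epsilon> * u) < 1" by (rule power_less_imp_less_base) simp
    show ?thesis
    proof (rule that)
      show "(\<lambda>n. ray_integral 1 w v n 1 - u * ray_integral u w v n \<epsilon>) \<in> powr_O e" for e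
        using bent_contour[OF True y \<epsilon>(1,2) corner[unfolded u_def]] unfolding u_def .
    qed (rule \<delta>\<^sub>0(2)[OF \<epsilon>(1,3)])
  qed
  have "(\<lambda>n. w * (of_real n ^ 1 * (ray_integral 1 w v n 1 - u * ray_integral u w v n \<delta>))) \<in> powr_O (- real R)"
    by (intro powr_O_cmult powr_O_mult'[OF powr_O_power[of 1] tail[of "- real R - 1"]]) simp
  from sum_in_bigo(1)[OF this main] show ?thesis
    unfolding S_fun_eq_ray_integral sum_delta_over_power[OF R] by (simp add: algebra_simps)
qed

text \<open>Direction u = -1 has rate b = w - 1 with positive real part. The minus sign of the
  expansion is that of u, and the constant -1 in T_n supplies the Kronecker delta.\<close>

lemma T_fun_expansion_right:
  assumes R: "R \<ge> 1" and w: "Re w > 1"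
  shows "(\<lambda>n. T_fun n w v - (- (\<Sum>r<R. U_coef r w v / of_real n ^ r))) \<in> powr_O (- real R)"
proof -
  have "Re ((1 - w) * - 1) > 0" using w by simp
  from U_ray_expansion[OF R this, of v] obtain \<delta> where \<delta>: "\<delta> > 0"
    "(\<lambda>n. of_real n * w * (- 1 * ray_integral (- 1) w v n \<delta>)
        - (\<Sum>r<R. (U_coef r w v - (if r = 0 then 1 else 0)) / of_real n ^ r)) \<in> powr_O (- real R)"
    by blast
  have tail: "(\<lambda>n. (T_fun n w v + 1) / (of_real n * w) - ray_integral (- 1) w v n \<delta>) \<in> powr_O (- real R - 1)"
    using w \<delta>(1) by (intro right_tail) auto
  have "(\<lambda>n. w * (of_real n ^ 1 * ((T_fun n w v + 1) / (of_real n * w) - ray_integral (- 1) w v n \<delta>))) \<in> powr_O (- real R)"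
    by (intro powr_O_cmult powr_O_mult'[OF powr_O_power[of 1] tail]) simp
  from sum_in_bigo(2)[OF this \<delta>(2)] show ?thesis
  proof (rule powr_O_cong)
    show "eventually (\<lambda>n. w * (of_real n ^ 1 * ((T_fun n w v + 1) / (of_real n * w) - ray_integral (- 1) w v n \<delta>))
        - (of_real n * w * (- 1 * ray_integral (- 1) w v n \<delta>)
           - (\<Sum>r<R. (U_coef r w v - (if r = 0 then 1 else 0)) / of_real n ^ r))
        = T_fun n w v - (- (\<Sum>r<R. U_coef r w v / of_real n ^ r))) at_top"
      using eventually_gt_at_top[of 0]
    proof eventually_elim
      case (elim n)
      have "w \<noteq> 0" using w by auto
      hence "w * (of_real n * ((T_fun n w v + 1) / (of_real n * w))) = T_fun n w v + 1"
        using elim by simp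
      thus ?case unfolding sum_delta_over_power[OF R] power_one_right right_diff_distrib
        by (simp add: algebra_simps)
    qed
  qed
qed

section \<open>Expansions at 1\<close>

lemma sum_lessThan_double: "(\<Sum>q<2 * R. f q) = (\<Sum>r<R. f (2 * r) + f (2 * r + 1))" for f :: "nat \<Rightarrow> complex"
  by (induction R) (simp_all add: algebra_simps)

text \<open>For p = 2 and u^2 = 1 the q-th Laplace coefficient is u^q times this number, so it
  serves both directions u = 1 and u = -1.\<close>

definition gauss_coeff :: "nat \<Rightarrow> complex \<Rightarrow> nat \<Rightarrow> complex" where
  "gauss_coeff M v q = (\<Sum>k<M. (-1) ^ k * phase_coeff 2 v k q / fact k * gaussian_moment (1/2) (2 * k + q))"

text \<open>For \<beta> = 1/2 the powers of 2 \<beta> are 1, and an even moment is a double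
  factorial times sqrt (2 pi) / 2; this is where the square root next to \<gamma>_r comes
  from.\<close>

lemma gauss_coeff_even:
  assumes "2 * r < M"
  shows "gauss_coeff M v (2 * r) = gamma_coef r v * of_real (sqrt (2 * pi) / 2)"
proof -
  define h where "h k = of_nat (dfact (int (2 * r + 2 * k) - 1)) / ((-1) ^ k * fact k :: complex)" for k
  have g: "gamma_coef r v = (\<Sum>k<M. h k * ((-1) ^ (2 * r) * phase_coeff 2 v k (2 * r)))"
    unfolding gamma_coef_def h_def using assms
    by (intro deMoivre_sum_eq_phase_coeff) (auto simp: seq3_def)
  have t: "(-1) ^ k * d / fact k * gaussian_moment (1/2) (2 * k + 2 * r) = h k * d * of_real (sqrt (2 * pi) / 2)" for k d
  proof -
    have "1 / (-1) ^ k = ((-1) ^ k :: complex)" by (simp add: uminus_power_if)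
    hence h: "h k = (-1) ^ k * of_nat (dfact (int (2 * k + 2 * r) - 1)) / fact k"
      unfolding h_def by (simp add: field_simps add.commute)
    have m: "gaussian_moment (1/2) (2 * k + 2 * r) = of_nat (dfact (int (2 * k + 2 * r) - 1)) * of_real (sqrt (2 * pi) / 2)"
      unfolding gaussian_moment_def by (simp add: mult.commute)
    show ?thesis unfolding h m by simp
  qed
  show ?thesis
    unfolding gauss_coeff_def t g sum_distrib_right by (simp add: mult_ac)
qed

text \<open>Odd moments contain no square root, only (2r+2k)!!. The sign (-1)^(2r+1) accounts for
  the minus in \<open>rho_coef\<close>.\<close>

lemma gauss_coeff_odd:
  assumes "2 * r + 1 < M"
  shows "gauss_coeff M v (2 * r + 1) = rho_coef r v - (if r = 0 then 1 else 0)"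
proof -
  define h where "h k = of_nat (dfact (int (2 * r + 2 * k))) / ((-1) ^ k * fact k :: complex)" for k
  have "rho_coef r v = (if r = 0 then 1 else 0) - (\<Sum>k<M. h k * ((-1) ^ (2 * r + 1) * phase_coeff 2 v k (2 * r + 1)))"
    unfolding rho_coef_def h_def using assms
    by (subst deMoivre_sum_eq_phase_coeff) (auto simp: seq3_def)
  moreover have "(-1) ^ k * d / fact k * gaussian_moment (1/2) (2 * k + (2 * r + 1)) = h k * d" for k d
  proof -
    have "1 / (-1) ^ k = ((-1) ^ k :: complex)" by (simp add: uminus_power_if)
    hence h: "h k = (-1) ^ k * of_nat (dfact (int (2 * k + 2 * r))) / fact k"
      unfolding h_def by (simp add: field_simps add.commute)
    have m: "gaussian_moment (1/2) (2 * k + (2 * r + 1)) = of_nat (dfact (int (2 * k + 2 * r)))"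
      unfolding gaussian_moment_def by simp
    show ?thesis unfolding h m by simp
  qed
  ultimately show ?thesis
    unfolding gauss_coeff_def by (simp add: sum_negf)
qed

text \<open>Even Taylor indices give sqrt n / n^r, odd ones u / n^r, so 2 R terms make R pairs. The
  error is n times n^(-(2R+1)/2), that is n^(-(R-1/2)).\<close>

lemma gauss_ray_expansion:
  assumes R: "R \<ge> 1" and u: "u\<^sup>2 = 1"
  obtains \<delta>\<^sub>0 where "\<delta>\<^sub>0 > 0" "\<And>\<delta>. 0 < \<delta> \<Longrightarrow> \<delta> \<le> \<delta>\<^sub>0 \<Longrightarrow>
      (\<lambda>n. of_real n * ray_integral u 1 v n \<delta>
          - (\<Sum>r<R. (1 / of_real n ^ r) * (gamma_coef r v / 2 * of_real (sqrt (2 * pi * n))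
               + u * (rho_coef r v - (if r = 0 then 1 else 0))))) \<in> powr_O (- (real R - 1 / 2))"
proof -
  define X where "X q = (\<Sum>k<2 * R. (- (u ^ 2)) ^ k * u ^ q * phase_coeff 2 v k q / fact k * gaussian_moment (1/2) (2 * k + q))" for q
  have X: "X q = u ^ q * gauss_coeff (2 * R) v q" for q
    unfolding X_def gauss_coeff_def sum_distrib_left u by (intro sum.cong) simp_all
  obtain \<delta>\<^sub>0 where \<delta>\<^sub>0: "\<delta>\<^sub>0 > 0" "\<And>\<delta>. 0 < \<delta> \<Longrightarrow> \<delta> \<le> \<delta>\<^sub>0 \<Longrightarrow>
      (\<lambda>n. integral {0..\<delta>} (\<lambda>t. exp (of_real n * 1 * (u * of_real t)) * (1 - u * of_real t) powr (of_real n + v))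
           - (\<Sum>r<2 * R. of_real (n powr (- real (r + 1) / real 2)) *
                (\<Sum>k<2 * R. (- (u ^ 2)) ^ k * u ^ r * phase_coeff 2 v k r / fact k * gaussian_moment (1/2) (2 * k + r))))
         \<in> powr_O (- real (2 * R + 1) / real 2)"
  proof (rule ray_expansion[of 2 "2 * R" "of_real (1/2)" 1 u "gaussian_moment (1/2)" v])
    \<comment> \<open>At w = 1 the linear terms cancel, and u^2 = 1 leaves - t^2 / 2.\<close>
    show "1 * u * of_real t - (\<Sum>j=1..2. (u * of_real t) ^ j / of_nat j) = - of_real (1/2) * of_real (t ^ 2)" for t
    proof -
      have "{1..2::nat} = {1, 2}" by auto
      thus ?thesis using u by (simp add: power_mult_distrib)
    qed
    show "(\<lambda>n. integral {0..\<delta>} (\<lambda>t. exp (- (of_real (n * t ^ 2) * of_real (1/2))) * of_real (t ^ l))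
                        - gaussian_moment (1/2) l * of_real (n powr (- real (l + 1) / real 2))) \<in> powr_O e" if "\<delta> > 0" for \<delta> l e
      by (rule gaussian_moments[OF that]) simp
    show "(\<lambda>n. of_real (integral {0..\<delta>} (\<lambda>t. exp (- (n * t ^ 2 * (Re (of_real (1/2)) / 2))) * t ^ l)))
             \<in> powr_O (- real (l + 1) / real 2)" if "\<delta> > 0" for \<delta> l
      by (rule moment_bound[where \<mu> = "gaussian_moment (Re (of_real (1/2)) / 2)"], rule gaussian_moments[OF that]) simp
  qed (use R that in auto)
  show ?thesis
  proof (rule that[OF \<delta>\<^sub>0(1)])
    fix \<delta> assume \<delta>: "0 < \<delta>" "\<delta> \<le> \<delta>\<^sub>0"
    have "(\<lambda>n. of_real n ^ 1 * (ray_integral u 1 v n \<delta> - (\<Sum>r<2 * R. of_real (n powr (- real (r + 1) / real 2)) * X r)))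
        \<in> powr_O (- (real R - 1 / 2))"
      using \<delta>\<^sub>0(2)[OF \<delta>] unfolding ray_integral_def X_def
      by (rule powr_O_mult'[OF powr_O_power[of 1]]) (simp add: field_simps)
    thus "(\<lambda>n. of_real n * ray_integral u 1 v n \<delta>
          - (\<Sum>r<R. (1 / of_real n ^ r) * (gamma_coef r v / 2 * of_real (sqrt (2 * pi * n))
               + u * (rho_coef r v - (if r = 0 then 1 else 0))))) \<in> powr_O (- (real R - 1 / 2))"
    proof (rule powr_O_cong)
      show "eventually (\<lambda>n. of_real n ^ 1 * (ray_integral u 1 v n \<delta> - (\<Sum>r<2 * R. of_real (n powr (- real (r + 1) / real 2)) * X r))
         = of_real n * ray_integral u 1 v n \<delta>
          - (\<Sum>r<R. (1 / of_real n ^ r) * (gamma_coef r v / 2 * of_real (sqrt (2 * pi * n))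
               + u * (rho_coef r v - (if r = 0 then 1 else 0))))) at_top"
        using eventually_gt_at_top[of 0]
      proof eventually_elim
        case (elim n)
        have pw: "n * n powr (- real (q + 1) / real 2) = n powr (1 / 2 - real q / 2)" for q
        proof -
          have "n powr (1 + - real (q + 1) / real 2) = n powr 1 * n powr (- real (q + 1) / real 2)"
            by (rule powr_add)
          moreover have "1 + - real (q + 1) / real 2 = 1 / 2 - real q / 2" by (simp add: field_simps)
          ultimately show ?thesis using elim by simp
        qed
        have even: "complex_of_real n * (of_real (n powr (- real (2 * r + 1) / real 2)) * X (2 * r))
            = (1 / of_real n ^ r) * (gamma_coef r v / 2 * of_real (sqrt (2 * pi * n)))" if "r < R" for r
        proof -
          have "n * n powr (- real (2 * r + 1) / real 2) = n powr (1 / 2 - real r)"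
            using pw[of "2 * r"] by simp
          also have "\<dots> = sqrt n / n ^ r"
            using elim by (simp add: powr_diff powr_half_sqrt powr_realpow)
          finally have f1: "complex_of_real n * of_real (n powr (- real (2 * r + 1) / real 2)) = of_real (sqrt n / n ^ r)"
            by (metis of_real_mult)
          have f2: "u ^ (2 * r) = 1" using u by (simp add: power_mult)
          have f3: "gauss_coeff (2 * R) v (2 * r) = gamma_coef r v * of_real (sqrt (2 * pi) / 2)"
            using that by (intro gauss_coeff_even) simp
          show ?thesis
            unfolding X f3 f2 mult.assoc [symmetric] f1 by (simp add: real_sqrt_mult mult_ac)
        qed
        have odd: "complex_of_real n * (of_real (n powr (- real (2 * r + 1 + 1) / real 2)) * X (2 * r + 1))
            = (1 / of_real n ^ r) * (u * (rho_coef r v - (if r = 0 then 1 else 0)))" if "r < R" for r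
        proof -
          have "n * n powr (- real (2 * r + 1 + 1) / real 2) = n powr (- real r)"
            using pw[of "2 * r + 1"] by (simp add: field_simps)
          also have "\<dots> = 1 / n ^ r"
            using elim by (simp add: powr_minus_divide powr_realpow)
          finally have "complex_of_real n * of_real (n powr (- real (2 * r + 1 + 1) / real 2)) = of_real (1 / n ^ r)"
            by (metis of_real_mult)
          moreover have "u ^ (2 * r + 1) = u" using u by (simp add: power_add power_mult)
          moreover have "gauss_coeff (2 * R) v (2 * r + 1) = rho_coef r v - (if r = 0 then 1 else 0)"
            using that by (intro gauss_coeff_odd) simp
          ultimately show ?thesis
            unfolding X mult.assoc [symmetric] by simp
        qed
        have "complex_of_real n * (\<Sum>r<2 * R. of_real (n powr (- real (r + 1) / real 2)) * X r)
            = (\<Sum>r<R. (1 / of_real n ^ r) * (gamma_coef r v / 2 * of_real (sqrt (2 * pi * n))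
               + u * (rho_coef r v - (if r = 0 then 1 else 0))))"
          unfolding sum_lessThan_double sum_distrib_left
        proof (rule sum.cong[OF refl])
          fix r assume "r \<in> {..<R}"
          hence r: "r < R" by simp
          show "complex_of_real n * (of_real (n powr (- real (2 * r + 1) / real 2)) * X (2 * r)
              + of_real (n powr (- real (2 * r + 1 + 1) / real 2)) * X (2 * r + 1))
             = (1 / of_real n ^ r) * (gamma_coef r v / 2 * of_real (sqrt (2 * pi * n))
               + u * (rho_coef r v - (if r = 0 then 1 else 0)))"
            unfolding distrib_left even[OF r] odd[OF r] ..
        qed
        thus ?case by (simp only: power_one_right right_diff_distrib)
      qed
    qed
  qed
qed

lemma sum_delta_over_power':
  assumes "R \<ge> 1"
  shows "(\<Sum>r<R. (1 / x ^ r) * (g r + u * (c r - (if r = 0 then 1 else 0)))) = (\<Sum>r<R. (1 / x ^ r) * (g r + u * c r)) - (u :: complex)"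
proof -
  have "(\<Sum>r<R. (1 / x ^ r) * (u * (if r = 0 then 1 else 0))) = (\<Sum>r<R. if r = 0 then u else 0)"
    by (intro sum.cong) auto
  thus ?thesis using assms by (simp add: algebra_simps diff_divide_distrib add_divide_distrib sum_subtractf sum.distrib)
qed

lemma S_fun_expansion_one:
  assumes R: "R \<ge> 1"
  shows "(\<lambda>n. S_fun n 1 v - (\<Sum>r<R. (1 / of_real n ^ r) * (rho_coef r v + gamma_coef r v / 2 * of_real (sqrt (2 * pi * n)))))
           \<in> powr_O (- (real R - 1 / 2))"
proof -
  obtain \<delta>\<^sub>0 where \<delta>\<^sub>0: "\<delta>\<^sub>0 > 0" "\<And>\<delta>. 0 < \<delta> \<Longrightarrow> \<delta> \<le> \<delta>\<^sub>0 \<Longrightarrow>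
      (\<lambda>n. of_real n * ray_integral 1 1 v n \<delta>
          - (\<Sum>r<R. (1 / of_real n ^ r) * (gamma_coef r v / 2 * of_real (sqrt (2 * pi * n))
               + 1 * (rho_coef r v - (if r = 0 then 1 else 0))))) \<in> powr_O (- (real R - 1 / 2))"
    by (rule gauss_ray_expansion[OF R, of 1 v]) (use that in auto)
  define \<delta> where "\<delta> = min \<delta>\<^sub>0 (1 / 2)"
  have \<delta>: "0 < \<delta>" "\<delta> \<le> \<delta>\<^sub>0" "\<delta> < 1" unfolding \<delta>_def using \<delta>\<^sub>0(1) by auto
  have "(\<lambda>n. of_real n ^ 1 * (ray_integral 1 1 v n 1 - ray_integral 1 1 v n \<delta>)) \<in> powr_O (- (real R - 1 / 2))"
    by (rule powr_O_mult'[OF powr_O_power[of 1] left_tail[of 1 \<delta> v "- (real R - 1 / 2) - 1"]]) (use \<delta> in auto)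
  from sum_in_bigo(1)[OF this \<delta>\<^sub>0(2)[OF \<delta>(1,2)]] show ?thesis
    unfolding S_fun_eq_ray_integral sum_delta_over_power'[OF R] by (simp add: algebra_simps)
qed

lemma T_fun_expansion_one:
  assumes R: "R \<ge> 1"
  shows "(\<lambda>n. T_fun n 1 v - (\<Sum>r<R. (1 / of_real n ^ r) * (- rho_coef r v + gamma_coef r v / 2 * of_real (sqrt (2 * pi * n)))))
           \<in> powr_O (- (real R - 1 / 2))"
proof -
  obtain \<delta> where \<delta>: "\<delta> > 0"
      "(\<lambda>n. of_real n * ray_integral (- 1) 1 v n \<delta>
          - (\<Sum>r<R. (1 / of_real n ^ r) * (gamma_coef r v / 2 * of_real (sqrt (2 * pi * n))
               + (- 1) * (rho_coef r v - (if r = 0 then 1 else 0))))) \<in> powr_O (- (real R - 1 / 2))"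
    by (rule gauss_ray_expansion[OF R, of "- 1" v]) (use that in auto)
  have "(\<lambda>n. of_real n ^ 1 * ((T_fun n 1 v + 1) / (of_real n * 1) - ray_integral (- 1) 1 v n \<delta>)) \<in> powr_O (- (real R - 1 / 2))"
    by (rule powr_O_mult'[OF powr_O_power[of 1] right_tail[of 1 \<delta> v "- (real R - 1 / 2) - 1"]]) (use \<delta> in auto)
  from sum_in_bigo(1)[OF this \<delta>(2)] show ?thesis
  proof (rule powr_O_cong)
    show "eventually (\<lambda>n. of_real n ^ 1 * ((T_fun n 1 v + 1) / (of_real n * 1) - ray_integral (- 1) 1 v n \<delta>)
        + (of_real n * ray_integral (- 1) 1 v n \<delta>
          - (\<Sum>r<R. (1 / of_real n ^ r) * (gamma_coef r v / 2 * of_real (sqrt (2 * pi * n))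
               + (- 1) * (rho_coef r v - (if r = 0 then 1 else 0)))))
        = T_fun n 1 v - (\<Sum>r<R. (1 / of_real n ^ r) * (- rho_coef r v + gamma_coef r v / 2 * of_real (sqrt (2 * pi * n))))) at_top"
      using eventually_gt_at_top[of 0]
    proof eventually_elim
      case (elim n)
      have "of_real n * ((T_fun n 1 v + 1) / (of_real n * 1)) = T_fun n 1 v + 1"
        using elim by simp
      moreover have "(\<Sum>r<R. (1 / of_real n ^ r) * (- rho_coef r v + gamma_coef r v / 2 * of_real (sqrt (2 * pi * n))))
          = (\<Sum>r<R. (1 / of_real n ^ r) * (gamma_coef r v / 2 * of_real (sqrt (2 * pi * n)) + (- 1) * rho_coef r v))"
        by (intro sum.cong) simp_all
      ultimately show ?case
        unfolding sum_delta_over_power'[OF R] by (simp only: power_one_right right_diff_distrib) simp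
    qed
  qed
qed

section \<open>Stirling's series and the regions\<close>

text \<open>The part of the Gamma term that is free of w, normalised at w = 1: it equals S_n(1;v) +
  T_n(1;v).\<close>

definition stirling_factor :: "real \<Rightarrow> complex \<Rightarrow> complex" where
  "stirling_factor n v = exp (of_real n) * exp (- (of_real n + v) * of_real (ln n)) * Gamma (of_real n + v + 1)"

text \<open>Collects the dependence of the Gamma term on w in (w e^(1-w))^(-n) w^(-v).\<close>

lemma T_fun_eq_stirling_factor:
  "T_fun n w v = exp (of_real n * (w - 1 - Ln w)) / exp (v * Ln w) * stirling_factor n v - S_fun n w v"
proof -
  have "of_real n * w + - (of_real n + v) * Ln w = of_real n * (w - 1 - Ln w) + of_real n - v * Ln w"
    by (simp add: algebra_simps)
  hence e: "exp (of_real n * w) * exp (- (of_real n + v) * Ln w)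
      = exp (of_real n * (w - 1 - Ln w)) * exp (of_real n) / exp (v * Ln w)"
    unfolding exp_add [symmetric] exp_diff [symmetric] by (simp only:)
  have gen: "a * b * c * g = x / y * (d * b * g)" if "a * c = x * d / y" for a b c d g x y :: complex
  proof -
    have "a * b * c * g = (a * c) * (b * g)" by (simp add: mult_ac)
    thus ?thesis unfolding that by simp
  qed
  show ?thesis unfolding T_fun_def stirling_factor_def gen[OF e] ..
qed

text \<open>Dividing by sqrt (2 pi n) improves the error n^(-(R-1/2)) of the two expansions at w = 1
  to n^(-R).\<close>

lemma stirling_expansion:
  assumes R: "R \<ge> 1"
  shows "(\<lambda>n. stirling_factor n v / of_real (sqrt (2 * pi * n)) - (\<Sum>r<R. gamma_coef r v / of_real n ^ r)) \<in> powr_O (- real R)"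
proof -
  have "(\<lambda>n. (T_fun n 1 v - (\<Sum>r<R. (1 / of_real n ^ r) * (- rho_coef r v + gamma_coef r v / 2 * of_real (sqrt (2 * pi * n)))))
      + (S_fun n 1 v - (\<Sum>r<R. (1 / of_real n ^ r) * (rho_coef r v + gamma_coef r v / 2 * of_real (sqrt (2 * pi * n))))))
      \<in> powr_O (- (real R - 1 / 2))"
    by (intro sum_in_bigo T_fun_expansion_one S_fun_expansion_one R)
  from powr_O_mult'[OF powr_O_powr[of "- 1 / 2"] this, of "- real R"]
  have "(\<lambda>n. of_real (1 / sqrt (2 * pi)) * (of_real (n powr (- 1 / 2)) *
      ((T_fun n 1 v - (\<Sum>r<R. (1 / of_real n ^ r) * (- rho_coef r v + gamma_coef r v / 2 * of_real (sqrt (2 * pi * n)))))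
      + (S_fun n 1 v - (\<Sum>r<R. (1 / of_real n ^ r) * (rho_coef r v + gamma_coef r v / 2 * of_real (sqrt (2 * pi * n))))))))
      \<in> powr_O (- real R)"
    by (intro powr_O_cmult) simp
  thus ?thesis
  proof (rule powr_O_cong)
    show "eventually (\<lambda>n. of_real (1 / sqrt (2 * pi)) * (of_real (n powr (- 1 / 2)) *
      ((T_fun n 1 v - (\<Sum>r<R. (1 / of_real n ^ r) * (- rho_coef r v + gamma_coef r v / 2 * of_real (sqrt (2 * pi * n)))))
      + (S_fun n 1 v - (\<Sum>r<R. (1 / of_real n ^ r) * (rho_coef r v + gamma_coef r v / 2 * of_real (sqrt (2 * pi * n)))))))
      = stirling_factor n v / of_real (sqrt (2 * pi * n)) - (\<Sum>r<R. gamma_coef r v / of_real n ^ r)) at_top"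
      using eventually_gt_at_top[of 0]
    proof eventually_elim
      case (elim n)
      define q where "q = complex_of_real (sqrt (2 * pi * n))"
      have q: "q \<noteq> 0" unfolding q_def using elim by simp
      have "1 / sqrt (2 * pi) * n powr (- 1 / 2) = 1 / sqrt (2 * pi * n)"
        using elim by (simp add: powr_minus_divide powr_half_sqrt real_sqrt_mult)
      hence inv: "of_real (1 / sqrt (2 * pi)) * complex_of_real (n powr (- 1 / 2)) = 1 / q"
        unfolding q_def by (metis of_real_1 of_real_divide of_real_mult)
      have TS: "T_fun n 1 v = stirling_factor n v - S_fun n 1 v"
        unfolding T_fun_eq_stirling_factor by simp
      have "(\<Sum>r<R. (1 / of_real n ^ r) * (- rho_coef r v + gamma_coef r v / 2 * q))
          + (\<Sum>r<R. (1 / of_real n ^ r) * (rho_coef r v + gamma_coef r v / 2 * q))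
          = (\<Sum>r<R. gamma_coef r v / of_real n ^ r) * q"
        unfolding sum.distrib [symmetric] sum_distrib_right
        by (intro sum.cong) (simp_all add: algebra_simps add_divide_distrib [symmetric])
      hence "(T_fun n 1 v - (\<Sum>r<R. (1 / of_real n ^ r) * (- rho_coef r v + gamma_coef r v / 2 * q)))
          + (S_fun n 1 v - (\<Sum>r<R. (1 / of_real n ^ r) * (rho_coef r v + gamma_coef r v / 2 * q)))
          = stirling_factor n v - (\<Sum>r<R. gamma_coef r v / of_real n ^ r) * q"
        unfolding TS by (simp only: diff_add_eq diff_diff_eq) (simp add: algebra_simps)
      thus ?case unfolding q_def [symmetric] mult.assoc [symmetric] inv
        using q by (simp add: diff_divide_distrib)
    qed
  qed
qed

section \<open>Orders of growth of the two terms of T_n\<close>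

lemma powr_O_sqrt: "(\<lambda>n. of_real (sqrt (2 * pi * n))) \<in> powr_O (1 / 2)"
proof (rule powr_O_I[of _ "sqrt (2 * pi)"])
  show "eventually (\<lambda>n. cmod (of_real (sqrt (2 * pi * n))) \<le> sqrt (2 * pi) * n powr (1 / 2)) at_top"
    using eventually_gt_at_top[of 0] by eventually_elim (simp add: real_sqrt_mult powr_half_sqrt norm_mult)
qed

lemma powr_O_inverse_sqrt: "(\<lambda>n. 1 / of_real (sqrt (2 * pi * n))) \<in> powr_O (- 1 / 2)"
proof (rule powr_O_I[of _ "1 / sqrt (2 * pi)"])
  show "eventually (\<lambda>n. cmod (1 / of_real (sqrt (2 * pi * n))) \<le> 1 / sqrt (2 * pi) * n powr (- 1 / 2)) at_top"
    using eventually_gt_at_top[of 0]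
    by eventually_elim (simp add: real_sqrt_mult powr_minus_divide powr_half_sqrt norm_divide norm_mult)
qed

lemma powr_O_const: "(\<lambda>n. c) \<in> powr_O 0"
  by (rule powr_O_I[of _ "cmod c"]) (rule eventually_mono[OF eventually_gt_at_top[of 0]], simp)

lemma stirling_factor_O: "(\<lambda>n. stirling_factor n v) \<in> powr_O (1 / 2)"
proof -
  have "(\<lambda>n. (stirling_factor n v / of_real (sqrt (2 * pi * n)) - (\<Sum>r<1. gamma_coef r v / of_real n ^ r)) + gamma_coef 0 v) \<in> powr_O 0"
    by (intro sum_in_bigo powr_O_const powr_O_mono[OF stirling_expansion]) auto
  hence "(\<lambda>n. stirling_factor n v / of_real (sqrt (2 * pi * n))) \<in> powr_O 0" by simp
  from powr_O_mult'[OF powr_O_sqrt this, of "1 / 2"]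
  have "(\<lambda>n. of_real (sqrt (2 * pi * n)) * (stirling_factor n v / of_real (sqrt (2 * pi * n)))) \<in> powr_O (1 / 2)" by simp
  thus ?thesis
    by (rule powr_O_cong) (rule eventually_mono[OF eventually_gt_at_top[of 0]], simp)
qed

lemma S_fun_O:
  assumes "Re w \<le> 1" "w \<noteq> 1"
  shows "(\<lambda>n. S_fun n w v) \<in> powr_O 0"
proof -
  have "(\<lambda>n. (S_fun n w v - (\<Sum>r<1. U_coef r w v / of_real n ^ r)) + U_coef 0 w v) \<in> powr_O 0"
    by (intro sum_in_bigo powr_O_const powr_O_mono[OF S_fun_expansion[OF _ assms]]) auto
  thus ?thesis by simp
qed

text \<open>Re (w - 1 - Ln w) = - ln |w exp (1 - w)|, so the region decides whether the Gamma term
  decays, oscillates or grows.\<close>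

lemma cmod_exp_wmod:
  assumes "w \<noteq> 0"
  shows "wmod w > 0" "cmod (exp (of_real n * (w - 1 - Ln w))) = exp (- (ln (wmod w) * n))"
proof -
  have wm: "wmod w = cmod w * exp (1 - Re w)" unfolding wmod_def norm_mult by simp
  show "wmod w > 0" unfolding wm using assms by simp
  have ln_wm: "ln (wmod w) = ln (cmod w) + (1 - Re w)" unfolding wm using assms by (subst ln_mult) auto
  show "cmod (exp (of_real n * (w - 1 - Ln w))) = exp (- (ln (wmod w) * n))"
    unfolding ln_wm using assms by (simp add: algebra_simps)
qed

section \<open>The regions, case by case\<close>

lemma T_fun_expansion_X:
  assumes R: "R \<ge> 1" and w: "w \<in> regX" "Re w \<le> 1"
  shows "(\<lambda>n. T_fun n w v - (- (\<Sum>r<R. U_coef r w v / of_real n ^ r))) \<in> powr_O (- real R)"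
proof -
  have wm: "wmod w > 1" using w by (simp add: regX_def)
  hence w01: "w \<noteq> 0" "w \<noteq> 1" by (auto simp: wmod_def)
  \<comment> \<open>The extra 1/2 in the exponent pays for the order sqrt n of
    \<open>stirling_factor\<close>.\<close>
  have E: "(\<lambda>n. exp (of_real n * (w - 1 - Ln w))) \<in> powr_O (- real R - 1 / 2)"
    by (rule powr_O_exp[of _ 1 "ln (wmod w)"]) (use cmod_exp_wmod[OF w01(1)] wm in auto)
  have "(\<lambda>n. 1 / exp (v * Ln w) * (exp (of_real n * (w - 1 - Ln w)) * stirling_factor n v)
          - (S_fun n w v - (\<Sum>r<R. U_coef r w v / of_real n ^ r))) \<in> powr_O (- real R)"
    by (intro sum_in_bigo powr_O_cmult powr_O_mult'[OF E stirling_factor_O] S_fun_expansion R w w01) simp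
  thus ?thesis unfolding T_fun_eq_stirling_factor by (simp add: algebra_simps)
qed

text \<open>The oscillating factor has modulus 1, so the error n^(-R) of Stirling's series is only
  multiplied by sqrt (2 pi n). The resulting n^(-(R-1/2)) outweighs the error n^(-R) of S_n.\<close>

lemma T_fun_expansion_S:
  assumes R: "R \<ge> 1" and w: "w \<in> regS"
  shows "(\<lambda>n. T_fun n w v - (\<Sum>r<R. (1 / of_real n ^ r) *
            (- U_coef r w v + gamma_coef r v * exp (\<i> * of_real (n * phi w)) / exp (v * Ln w) * of_real (sqrt (2 * pi * n)))))
          \<in> powr_O (- (real R - 1/2))"
proof -
  have wm: "wmod w = 1" "Re w < 1" using w by (auto simp: regS_def)
  hence w01: "w \<noteq> 0" "w \<noteq> 1" "Re w \<le> 1" by (auto simp: wmod_def)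
  define V where "V = exp (v * Ln w)"
  define h where "h n = stirling_factor n v / of_real (sqrt (2 * pi * n)) - (\<Sum>r<R. gamma_coef r v / of_real n ^ r)" for n
  \<comment> \<open>|w exp (1 - w)| = 1 makes w - 1 - Ln w purely imaginary, with imaginary part Im
    w - Arg w.\<close>
  have phase: "exp (of_real n * (w - 1 - Ln w)) = exp (\<i> * of_real (n * phi w))" for n
  proof -
    have "cmod (exp (of_real 1 * (w - 1 - Ln w))) = 1"
      using cmod_exp_wmod(2)[OF w01(1), of 1] wm by simp
    hence "Re (w - 1 - Ln w) = 0" by simp
    moreover have "Im (w - 1 - Ln w) = phi w"
      using w01(1) by (simp add: phi_def Arg_eq_Im_Ln)
    ultimately have "w - 1 - Ln w = \<i> * of_real (phi w)"
      by (simp add: complex_eq_iff)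
    hence "of_real n * (w - 1 - Ln w) = \<i> * of_real (n * phi w)" by simp
    thus ?thesis by (simp only:)
  qed
  have E: "(\<lambda>n. exp (\<i> * of_real (n * phi w))) \<in> powr_O 0"
    by (rule powr_O_I[of _ 1]) (rule eventually_mono[OF eventually_gt_at_top[of 0]], simp)
  have hO: "h \<in> powr_O (- real R)" unfolding h_def by (rule stirling_expansion[OF R])
  have SO: "(\<lambda>n. S_fun n w v - (\<Sum>r<R. U_coef r w v / of_real n ^ r)) \<in> powr_O (- (real R - 1 / 2))"
    by (rule powr_O_mono[OF S_fun_expansion]) (use R w01 in auto)
  have sh: "(\<lambda>n. of_real (sqrt (2 * pi * n)) * h n) \<in> powr_O (- (real R - 1 / 2))"
    by (rule powr_O_mult'[OF powr_O_sqrt hO]) simp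
  have "(\<lambda>n. 1 / V * (exp (\<i> * of_real (n * phi w)) * (of_real (sqrt (2 * pi * n)) * h n))
          - (S_fun n w v - (\<Sum>r<R. U_coef r w v / of_real n ^ r))) \<in> powr_O (- (real R - 1 / 2))"
    by (intro sum_in_bigo powr_O_cmult powr_O_mult'[OF E sh] SO) simp
  thus ?thesis
  proof (rule powr_O_cong)
    show "eventually (\<lambda>n. 1 / V * (exp (\<i> * of_real (n * phi w)) * (of_real (sqrt (2 * pi * n)) * h n))
          - (S_fun n w v - (\<Sum>r<R. U_coef r w v / of_real n ^ r))
        = T_fun n w v - (\<Sum>r<R. (1 / of_real n ^ r) *
            (- U_coef r w v + gamma_coef r v * exp (\<i> * of_real (n * phi w)) / exp (v * Ln w) * of_real (sqrt (2 * pi * n))))) at_top"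
      using eventually_gt_at_top[of 0]
    proof eventually_elim
      case (elim n)
      define q where "q = complex_of_real (sqrt (2 * pi * n))"
      define e where "e = exp (\<i> * of_real (n * phi w))"
      have q: "q \<noteq> 0" unfolding q_def using elim by simp
      have qh: "q * h n = stirling_factor n v - q * (\<Sum>r<R. gamma_coef r v / of_real n ^ r)"
        unfolding h_def q_def [symmetric] right_diff_distrib using q by simp
      have "(\<Sum>r<R. (1 / of_real n ^ r) * (- U_coef r w v + gamma_coef r v * e / V * q))
          = 1 / V * (e * (q * (\<Sum>r<R. gamma_coef r v / of_real n ^ r))) - (\<Sum>r<R. U_coef r w v / of_real n ^ r)"
        unfolding sum_distrib_left sum_subtractf [symmetric]
        by (intro sum.cong) (simp_all add: algebra_simps diff_divide_distrib)
      thus ?case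
        unfolding T_fun_eq_stirling_factor phase V_def [symmetric] q_def [symmetric] e_def [symmetric] qh
        unfolding right_diff_distrib by simp
    qed
  qed
qed

lemma T_fun_expansion_Y:
  assumes R: "R \<ge> 1" and w: "w \<in> regY" "w \<noteq> 0"
  shows "\<exists>h :: real \<Rightarrow> complex. h \<in> powr_O (- real R) \<and>
          (\<forall>\<^sub>F n in at_top. T_fun n w v =
             of_real (sqrt (2 * pi * n)) / (exp (of_real n * Ln w + of_real n * (1 - w)) * exp (v * Ln w))
               * ((\<Sum>r<R. gamma_coef r v / of_real n ^ r) + h n))"
proof -
  have wm: "wmod w < 1" "Re w < 1" using w by (auto simp: regY_def)
  hence w1: "w \<noteq> 1" "Re w \<le> 1" by auto
  define V where "V = exp (v * Ln w)"
  define A where "A n = exp (of_real n * Ln w + of_real n * (1 - w))" for n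
  define h0 where "h0 n = stirling_factor n v / of_real (sqrt (2 * pi * n)) - (\<Sum>r<R. gamma_coef r v / of_real n ^ r)" for n
  \<comment> \<open>S_n divided by the prefactor joins the error: it carries \<open>A n\<close> = (w
    e^(1-w))^n, which is exponentially small in Y.\<close>
  define h where "h n = h0 n - V * (A n * (1 / of_real (sqrt (2 * pi * n)) * S_fun n w v))" for n
  have A_eq: "A n = 1 / exp (of_real n * (w - 1 - Ln w))" for n
  proof -
    have "of_real n * Ln w + of_real n * (1 - w) = - (of_real n * (w - 1 - Ln w))"
      by (simp add: algebra_simps)
    thus ?thesis unfolding A_def by (simp only: exp_minus inverse_eq_divide)
  qed
  have "cmod (A n) = exp (- (- ln (wmod w) * n))" for n
    unfolding A_eq norm_divide cmod_exp_wmod(2)[OF w(2)] by (simp add: exp_minus field_simps)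
  hence AO: "A \<in> powr_O (- real R + 1 / 2)"
    by (intro powr_O_exp[of _ 1 "- ln (wmod w)"]) (use wm cmod_exp_wmod(1)[OF w(2)] in auto)
  have h0: "h0 \<in> powr_O (- real R)" unfolding h0_def by (rule stirling_expansion[OF R])
  have SO: "(\<lambda>n. 1 / of_real (sqrt (2 * pi * n)) * S_fun n w v) \<in> powr_O (- 1 / 2)"
    by (rule powr_O_mult'[OF powr_O_inverse_sqrt S_fun_O]) (use w1 in auto)
  have hO: "h \<in> powr_O (- real R)"
    unfolding h_def by (intro sum_in_bigo h0 powr_O_cmult powr_O_mult'[OF AO SO]) simp
  have "eventually (\<lambda>n. T_fun n w v = of_real (sqrt (2 * pi * n)) / (A n * V)
               * ((\<Sum>r<R. gamma_coef r v / of_real n ^ r) + h n)) at_top"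
    using eventually_gt_at_top[of 0]
  proof eventually_elim
    case (elim n)
    define q where "q = complex_of_real (sqrt (2 * pi * n))"
    have q: "q \<noteq> 0" unfolding q_def using elim by simp
    have nz: "A n \<noteq> 0" "V \<noteq> 0" unfolding A_def V_def by auto
    have "exp (of_real n * (w - 1 - Ln w)) = 1 / A n" unfolding A_eq by simp
    hence "T_fun n w v = 1 / A n / V * stirling_factor n v - S_fun n w v"
      unfolding T_fun_eq_stirling_factor V_def by (simp only:)
    also have "\<dots> = q / (A n * V) * (stirling_factor n v / q - V * (A n * (1 / q * S_fun n w v)))"
      using q nz by (simp add: field_simps)
    also have "stirling_factor n v / q - V * (A n * (1 / q * S_fun n w v)) = (\<Sum>r<R. gamma_coef r v / of_real n ^ r) + h n"
      unfolding h_def h0_def q_def by simp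
    finally show ?case unfolding q_def .
  qed
  thus ?thesis using hO unfolding A_def V_def by blast
qed

theorem theorem5p4:
  fixes v :: complex and R :: nat
  assumes "R \<ge> 1"
  shows
   "(\<lambda>n::real. T_fun n 1 v
       - (\<Sum>r<R. (1 / of_real n ^ r) *
            (- rho_coef r v + gamma_coef r v / 2 * of_real (sqrt (2 * pi * n)))))
      \<in> O[at_top](\<lambda>n. of_real (n powr (- (real R - 1/2))))
    \<and> (\<forall>w \<in> regX \<union> regZ \<union> regT.
        (\<lambda>n::real. T_fun n w v - (- (\<Sum>r<R. U_coef r w v / of_real n ^ r)))
          \<in> O[at_top](\<lambda>n. of_real (n powr (- real R))))
    \<and> (\<forall>w \<in> regS.
        (\<lambda>n::real. T_fun n w v
           - (\<Sum>r<R. (1 / of_real n ^ r) *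
                (- U_coef r w v + gamma_coef r v * exp (\<i> * of_real (n * phi w)) / exp (v * Ln w)
                    * of_real (sqrt (2 * pi * n)))))
          \<in> O[at_top](\<lambda>n. of_real (n powr (- (real R - 1/2)))))
    \<and> (\<forall>w \<in> regY. w \<noteq> 0 \<longrightarrow>
        (\<exists>h :: real \<Rightarrow> complex. h \<in> O[at_top](\<lambda>n. of_real (n powr (- real R))) \<and>
          (\<forall>\<^sub>F n in at_top. T_fun n w v =
             of_real (sqrt (2 * pi * n)) / (exp (of_real n * Ln w + of_real n * (1 - w)) * exp (v * Ln w))
               * ((\<Sum>r<R. gamma_coef r v / of_real n ^ r) + h n))))"
proof (intro conjI ballI impI)
  show "(\<lambda>n. T_fun n w v - (- (\<Sum>r<R. U_coef r w v / of_real n ^ r))) \<in> powr_O (- real R)"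
    if w: "w \<in> regX \<union> regZ \<union> regT" for w
  proof (cases "Re w > 1")
    case True
    show ?thesis by (rule T_fun_expansion_right[OF assms True])
  next
    case False
    \<comment> \<open>Z and T lie in Re w > 1, so only points of X remain here.\<close>
    with w have "w \<in> regX" by (auto simp: regZ_def regT_def)
    thus ?thesis using False by (intro T_fun_expansion_X assms) auto
  qed
qed (intro T_fun_expansion_one T_fun_expansion_S T_fun_expansion_Y assms; assumption)+

end
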